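(* For an order $\mathcal{O}$ in a quadratic field, let $\mathcal{I}_3(\mathcal{O})$ be the $3$-torsion subgroup of its ideal group. When orders in quadratic fields are ordered by their absolute discriminants, the average number of $3$-torsion elements in the ideal groups of either imaginary or real quadratic orders is $\frac{\zeta(2)}{\zeta(3)}$; i.e. $$\lim_{X\to\infty}\frac{\sum_{0<-\mathrm{Disc}(\mathcal{O})<X}|\mathcal{I}_3(\mathcal{O})|}{\sum_{0<-\mathrm{Disc}(\mathcal{O})<X}1}=\frac{\zeta(2)}{\zeta(3)}\qquad\text{and}\qquad \lim_{X\to\infty}\frac{\sum_{0<\mathrm{Disc}(\mathcal{O})<X}|\mathcal{I}_3(\mathcal{O})|}{\sum_{0<\mathrm{Disc}(\mathcal{O})<X}1}=\frac{\zeta(2)}{\zeta(3)}.$$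
   Context: A quadratic order is an order $\mathcal{O}$ in a quadratic field, imaginary or real according as $\mathrm{Disc}(\mathcal{O})<0$ or $>0$; sums run over isomorphism classes of orders in quadratic fields. The ideal group $\mathcal{I}(\mathcal{O})$ is the group of invertible fractional ideals of $\mathcal{O}$ (not modulo principal ideals), and $\mathcal{I}_3(\mathcal{O})=\{I\in\mathcal{I}(\mathcal{O}):I^3=\mathcal{O}\}$ (including the trivial ideal $\mathcal{O}$). $\zeta$ is the Riemann zeta function. *)

theory Defs
  imports Complex_Main
begin

text \<open>
  Every quadratic field embeds into the complex numbers, so quadratic fields are taken to be
  subfields of \<^typ>\<open>complex\<close> and orders to be subrings of them. Isomorphism classes are then
  formed explicitly. The following interpretations view \<^typ>\<open>complex\<close> as a module over
  the integers and as a vector space over the rationals.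
\<close>

interpretation int_mod: module "\<lambda>(n::int) (z::complex). of_int n * z"
  by unfold_locales (simp_all add: algebra_simps)

interpretation rat_vec: vector_space "\<lambda>(q::rat) (z::complex). of_rat q * z"
  by unfold_locales (simp_all add: algebra_simps of_rat_add of_rat_mult)

definition is_subring :: "complex set \<Rightarrow> bool" where
  "is_subring R \<longleftrightarrow> 1 \<in> R \<and> (\<forall>x\<in>R. \<forall>y\<in>R. x - y \<in> R \<and> x * y \<in> R)"

definition is_subfield :: "complex set \<Rightarrow> bool" where
  "is_subfield K \<longleftrightarrow> is_subring K \<and> (\<forall>x\<in>K. inverse x \<in> K)"

definition quadratic_field :: "complex set \<Rightarrow> bool" where
  "quadratic_field K \<longleftrightarrow> is_subfield K \<and> rat_vec.dim K = 2"

definition order_in :: "complex set \<Rightarrow> complex set \<Rightarrow> bool" where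
  "order_in K R \<longleftrightarrow>
     is_subring R \<and> (\<exists>B. finite B \<and> int_mod.span B = R) \<and> rat_vec.span R = K"

definition quadratic_order :: "complex set \<Rightarrow> bool" where
  "quadratic_order R \<longleftrightarrow> (\<exists>K. quadratic_field K \<and> order_in K R)"

definition fraction_field :: "complex set \<Rightarrow> complex set" where
  "fraction_field R = {x / y | x y. x \<in> R \<and> y \<in> R \<and> y \<noteq> 0}"

text \<open>
  The trace of multiplication by \<open>x\<close> on the rational vector space \<open>K\<close>; it does not depend on
  the basis chosen.
\<close>

definition field_trace :: "complex set \<Rightarrow> complex \<Rightarrow> rat" where
  "field_trace K x =
     (let B = (SOME B. rat_vec.independent B \<and> rat_vec.span B = K)
      in \<Sum>b\<in>B. rat_vec.representation B (x * b) b)"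

text \<open>
  The determinant of the trace form on a \<open>\<int>\<close>-basis \<open>(a, b)\<close>; it is an integer and does not
  depend on the basis chosen. It is meaningful for quadratic orders only.
\<close>

definition Disc :: "complex set \<Rightarrow> int" where
  "Disc R = (THE d. \<exists>a b. a \<noteq> b \<and> \<not> int_mod.dependent {a, b} \<and> int_mod.span {a, b} = R \<and>
     (let Tr = field_trace (fraction_field R)
      in of_int d = Tr (a * a) * Tr (b * b) - Tr (a * b) * Tr (b * a)))"

definition fractional_ideal :: "complex set \<Rightarrow> complex set \<Rightarrow> bool" where
  "fractional_ideal R I \<longleftrightarrow>
     I \<subseteq> fraction_field R \<and> int_mod.subspace I \<and> (\<forall>r\<in>R. \<forall>x\<in>I. r * x \<in> I) \<and> I \<noteq> {0} \<and>
     (\<exists>d\<in>R. d \<noteq> 0 \<and> (\<forall>x\<in>I. d * x \<in> R))"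

definition ideal_mult :: "complex set \<Rightarrow> complex set \<Rightarrow> complex set" where
  "ideal_mult I J = int_mod.span {x * y | x y. x \<in> I \<and> y \<in> J}"

definition ideal_group :: "complex set \<Rightarrow> complex set set" where
  "ideal_group R =
     {I. fractional_ideal R I \<and> (\<exists>J. fractional_ideal R J \<and> ideal_mult I J = R)}"

definition ideal_group_3_torsion :: "complex set \<Rightarrow> complex set set" where
  "ideal_group_3_torsion R = {I \<in> ideal_group R. ideal_mult I (ideal_mult I I) = R}"

definition order_iso :: "(complex set \<times> complex set) set" where
  "order_iso = {(R, S). quadratic_order R \<and> quadratic_order S \<and>
     (\<exists>f. bij_betw f R S \<and> f 1 = 1 \<and>
        (\<forall>x\<in>R. \<forall>y\<in>R. f (x + y) = f x + f y \<and> f (x * y) = f x * f y))}"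

definition order_classes :: "complex set set set" where
  "order_classes = {R. quadratic_order R} // order_iso"

text \<open>
  Discriminant and number of 3-torsion ideals are invariant under isomorphism, so they may be
  evaluated at any representative.
\<close>

definition class_rep :: "complex set set \<Rightarrow> complex set" where
  "class_rep C = (SOME R. R \<in> C)"

definition imaginary_classes :: "real \<Rightarrow> complex set set set" where
  "imaginary_classes X =
     {C \<in> order_classes. 0 < - Disc (class_rep C) \<and> of_int (- Disc (class_rep C)) < X}"

definition real_classes :: "real \<Rightarrow> complex set set set" where
  "real_classes X =
     {C \<in> order_classes. 0 < Disc (class_rep C) \<and> of_int (Disc (class_rep C)) < X}"

text \<open>The Dirichlet series of the Riemann zeta function, for real arguments greater than 1.\<close>

definition zeta :: "real \<Rightarrow> real" where
  "zeta s = (\<Sum>n. 1 / real (Suc n) powr s)"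

end

(*
An order of discriminant D is the ring R = Z[(D + d)/2] with d a square root of D, so order
classes correspond to the nonsquare D congruent to 0 or 1 modulo 4. A fractional ideal has the form
v(Zm + Zr) with R = Z[r]; when it is invertible, comparing indices in I^3 = R forces m = mu^2 and
v = 1/mu, and one finds I = Z mu + Z(s + d/mu)/2 with s coprime to mu, s modulo 2 mu and
4 mu^3 | D + 3 mu^2 s^2; all such pairs (mu, s) occur. For fixed mu the number of pairs (D, s) with
|D| < X is asymptotic to 2 phi(mu) X/(4 mu^3), and it is O(X mu^(-3/2)) uniformly in X because the
congruence leaves O(sqrt mu) choices for s, a bounded number for each divisor of mu. By Tannery's
theorem the numerator is asymptotic to (X/2) sum phi(mu)/mu^3 = (X/2) zeta(2)/zeta(3), while the
number of discriminants is asymptotic to X/2.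
*)
theory Submission
  imports Defs "HOL-Analysis.Analysis" "HOL-Number_Theory.Number_Theory"
begin

section \<open>Discriminants in arithmetic progressions\<close>

text \<open>For one level mu the pairs (D, s) fill 2 phi(mu) residue classes modulo 4 mu^3. Even an
  error of O(1) per class is too much in the sum over levels: mu^2 divides D, so mu runs up to sqrt
  X, and the sum of phi(mu) over that range has the order X of the main term. For the uniform bound
  the count is therefore turned round: D comes first, of its divisibility only mu^2 | D is kept, and
  for each D the roots s are bounded through the divisors of mu. No additive error occurs, so the
  bound holds for all mu and X at once.

  Indices of ideals are replaced by explicit coordinates: the cube of v(Zm + Zr) has four
  generators, and up to the factor v^3 the 2 by 2 minors of their coordinates have greatest common
  divisor m^3 exactly when m, the trace of r and the norm of r divided by m have no common factor.
  This primitivity expresses invertibility; it is derived from I^3 = R by looking at multipliers of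
  I.\<close>

lemma card_int_open_interval:
  fixes a b :: real
  assumes "a \<le> b"
  shows "\<bar>real (card {j::int. a < of_int j \<and> of_int j < b}) - (b - a)\<bar> \<le> 1"
proof -
  have "{j::int. a < of_int j \<and> of_int j < b} = {\<lfloor>a\<rfloor> + 1..\<lceil>b\<rceil> - 1}"
    by (auto simp: floor_less_iff less_ceiling_iff; linarith)
  then have "card {j::int. a < of_int j \<and> of_int j < b} = nat (\<lceil>b\<rceil> - 1 - \<lfloor>a\<rfloor>)"
    by simp
  \<comment> \<open>The truncation by \<open>nat\<close> matters only if a = b is an integer, and
    then the count is 0.\<close>
  then show ?thesis
    using assms by (cases "\<lceil>b\<rceil> - 1 - \<lfloor>a\<rfloor> \<ge> 0") (simp_all, linarith+)
qed

lemma card_arith_progression: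
  fixes M r :: int and X :: real
  assumes "M > 0" "X \<ge> 0"
  shows "\<bar>real (card {n::int. 0 < n \<and> of_int n < X \<and> M dvd n + r}) - X / of_int M\<bar> \<le> 1"
proof -
  let ?J = "{j::int. of_int r / of_int M < (of_int j :: real) \<and> of_int j < (X + of_int r) / of_int M}"
  have "bij_betw (\<lambda>j. M * j - r) ?J {n::int. 0 < n \<and> of_int n < X \<and> M dvd n + r}"
  proof (rule bij_betw_imageI)
    show "inj_on (\<lambda>j. M * j - r) ?J" using assms by (auto simp: inj_on_def)
    show "(\<lambda>j. M * j - r) ` ?J = {n::int. 0 < n \<and> of_int n < X \<and> M dvd n + r}"
    proof (intro equalityI subsetI)
      fix n assume "n \<in> (\<lambda>j. M * j - r) ` ?J"
      then obtain j where j: "n = M * j - r" "of_int r / of_int M < (of_int j :: real)"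
        "of_int j < (X + of_int r) / of_int M" by auto
      have "(of_int r :: real) < of_int (M * j)" using j(2) assms by (simp add: field_simps)
      then have "r < M * j" by (simp only: of_int_less_iff)
      moreover have "(of_int (M * j) :: real) < X + of_int r" using j(3) assms by (simp add: field_simps)
      ultimately show "n \<in> {n::int. 0 < n \<and> of_int n < X \<and> M dvd n + r}" using j(1) by auto
    next
      fix n assume "n \<in> {n::int. 0 < n \<and> of_int n < X \<and> M dvd n + r}"
      then obtain j where j: "n + r = M * j" "0 < n" "of_int n < X" by (auto elim: dvdE)
      then have n: "n = M * j - r" by simp
      have "r < M * j" using j by simp
      then have "(of_int r :: real) < of_int M * of_int j" by (metis of_int_less_iff of_int_mult)
      moreover have "of_int M * (of_int j :: real) < X + of_int r" using j(3) n by simp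
      ultimately have "j \<in> ?J" using assms by (simp add: field_simps)
      then show "n \<in> (\<lambda>j. M * j - r) ` ?J" using n by blast
    qed
  qed
  then have "card {n::int. 0 < n \<and> of_int n < X \<and> M dvd n + r} = card ?J"
    by (simp add: bij_betw_same_card)
  moreover have "\<bar>real (card ?J) - ((X + of_int r) / of_int M - of_int r / of_int M)\<bar> \<le> 1"
    by (rule card_int_open_interval) (use assms in \<open>auto simp: divide_right_mono\<close>)
  ultimately show ?thesis by (simp add: add_divide_distrib)
qed

text \<open>The sign \<open>e\<close> is 1 or -1 in all applications, so \<open>e * D\<close> is the
  absolute value of \<open>D\<close>; this treats real and imaginary orders together.\<close>

definition nonsquares :: "int \<Rightarrow> real \<Rightarrow> int set" where
  "nonsquares e X = {D. 0 < e * D \<and> of_int (e * D) < X \<and> \<not> (\<exists>k. D = k\<^sup>2)}"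

lemma finite_signed_interval:
  assumes "\<bar>e\<bar> = (1::int)"
  shows "finite {D::int. 0 < e * D \<and> of_int (e * D) < (X::real)}"
proof (rule finite_subset)
  show "{D::int. 0 < e * D \<and> of_int (e * D) < X} \<subseteq> {-\<lceil>X\<rceil>..\<lceil>X\<rceil>}"
    using assms by (auto simp: abs_if split: if_splits) linarith+
qed simp

lemma finite_nonsquares: "\<bar>e\<bar> = 1 \<Longrightarrow> finite (nonsquares e X)"
  by (rule finite_subset[OF _ finite_signed_interval[of e X]]) (auto simp: nonsquares_def)

text \<open>Squares are nonnegative, so for negative \<open>e\<close> there are none, and for
  positive \<open>e\<close> the roots are bounded by sqrt X.\<close>

lemma card_squares_le:
  assumes "X \<ge> 0"
  shows "real (card {D::int. 0 < e * D \<and> of_int (e * D) < X \<and> (\<exists>k. D = k\<^sup>2)}) \<le> sqrt X + 1"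
proof -
  have "{D::int. 0 < e * D \<and> of_int (e * D) < X \<and> (\<exists>k. D = k\<^sup>2)} \<subseteq> (\<lambda>k. k\<^sup>2) ` {0..\<lfloor>sqrt X\<rfloor>}"
  proof
    fix D assume "D \<in> {D::int. 0 < e * D \<and> of_int (e * D) < X \<and> (\<exists>k. D = k\<^sup>2)}"
    then obtain k where k: "D = k\<^sup>2" "0 < e * D" "of_int (e * D) < X" by auto
    then have "0 < e" "D \<ge> 0" by (auto simp: zero_less_mult_iff)
    then have "D \<le> e * D" by (simp add: mult_le_cancel_right1)
    then have "of_int D < X" using k(3) by linarith
    then have "(of_int \<bar>k\<bar>)\<^sup>2 \<le> X" using k by simp
    then have "of_int \<bar>k\<bar> \<le> sqrt X" using real_le_rsqrt by blast
    then have "\<bar>k\<bar> \<in> {0..\<lfloor>sqrt X\<rfloor>}" by (simp add: le_floor_iff)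
    moreover have "D = \<bar>k\<bar>\<^sup>2" using k by simp
    ultimately show "D \<in> (\<lambda>k. k\<^sup>2) ` {0..\<lfloor>sqrt X\<rfloor>}" by blast
  qed
  then have "card {D::int. 0 < e * D \<and> of_int (e * D) < X \<and> (\<exists>k. D = k\<^sup>2)} \<le> card {0..\<lfloor>sqrt X\<rfloor>}"
    by (meson card_image_le card_mono finite_atLeastAtMost_int finite_imageI le_trans)
  also have "\<dots> = nat (\<lfloor>sqrt X\<rfloor> + 1)" by simp
  finally have "real (card {D::int. 0 < e * D \<and> of_int (e * D) < X \<and> (\<exists>k. D = k\<^sup>2)}) \<le> real (nat (\<lfloor>sqrt X\<rfloor> + 1))"
    by linarith
  also have "\<dots> = of_int (\<lfloor>sqrt X\<rfloor> + 1)"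
    using assms by (subst of_nat_nat) auto
  finally show ?thesis by linarith
qed

text \<open>Multiplication by \<open>e\<close> moves the count to positive integers, where the
  progression costs an error of 1; the discarded squares cost at most sqrt X + 1 more.\<close>

lemma card_nonsquares_progression:
  fixes M r e :: int
  assumes "\<bar>e\<bar> = 1" "M > 0" "X \<ge> 0"
  shows "\<bar>real (card {D \<in> nonsquares e X. M dvd D + r}) - X / of_int M\<bar> \<le> sqrt X + 2"
proof -
  let ?A = "{D. 0 < e * D \<and> of_int (e * D) < X \<and> M dvd D + r}"
  let ?S = "{D. 0 < e * D \<and> of_int (e * D) < X \<and> (\<exists>k. D = k\<^sup>2)}"
  let ?N = "{D \<in> nonsquares e X. M dvd D + r}"
  have ee: "e * e = 1" using assms(1) by (auto simp: abs_if split: if_splits)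
  have "bij_betw (\<lambda>n. e * n) ?A {n::int. 0 < n \<and> of_int n < X \<and> M dvd n + e * r}"
  proof (rule bij_betw_imageI)
    show "inj_on (\<lambda>n. e * n) ?A" using assms(1) by (auto simp: inj_on_def)
    have dvd_iff: "M dvd e * n + e * r \<longleftrightarrow> M dvd n + r" for n
      using assms(1) dvd_mult_unit_iff'[of e M "n + r"] by (auto simp: distrib_left)
    moreover have inv: "e * (e * n) = n" for n using ee by (metis mult.assoc mult_1)
    ultimately have "n \<in> (\<lambda>n. e * n) ` ?A" if "0 < n" "of_int n < X" "M dvd n + e * r" for n
      using that by (intro image_eqI[of _ _ "e * n"]) (auto simp del: of_int_mult simp: inv simp flip: dvd_iff)
    then show "(\<lambda>n. e * n) ` ?A = {n::int. 0 < n \<and> of_int n < X \<and> M dvd n + e * r}"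
      using dvd_iff by (auto simp del: of_int_mult)
  qed
  then have "card ?A = card {n::int. 0 < n \<and> of_int n < X \<and> M dvd n + e * r}"
    by (rule bij_betw_same_card)
  then have A: "\<bar>real (card ?A) - X / of_int M\<bar> \<le> 1"
    using card_arith_progression[OF assms(2,3), of "e * r"] by simp
  have fin: "finite ?A" "finite ?S"
    by (rule finite_subset[OF _ finite_signed_interval[OF assms(1), of X]], auto)+
  have "card ?N \<le> card ?A" by (rule card_mono[OF fin(1)]) (auto simp: nonsquares_def)
  moreover have "card ?A \<le> card (?N \<union> ?S)"
  proof (rule card_mono)
    show "finite (?N \<union> ?S)" using fin finite_nonsquares[OF assms(1)] by simp
  qed (auto simp: nonsquares_def)
  then have "card ?A \<le> card ?N + card ?S" using card_Un_le[of ?N ?S] by linarith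
  ultimately show ?thesis using A card_squares_le[OF assms(3), of e] by linarith
qed

lemma density_nonsquares_progression:
  fixes M r e :: int
  assumes "\<bar>e\<bar> = 1" "M > 0"
  shows "((\<lambda>X. real (card {D \<in> nonsquares e X. M dvd D + r}) / X) \<longlongrightarrow> 1 / of_int M) at_top"
proof -
  have "((\<lambda>X. real (card {D \<in> nonsquares e X. M dvd D + r}) / X - 1 / of_int M) \<longlongrightarrow> 0) at_top"
  proof (rule Lim_null_comparison)
    show "\<forall>\<^sub>F X in at_top. norm (real (card {D \<in> nonsquares e X. M dvd D + r}) / X - 1 / of_int M)
        \<le> 1 / sqrt X + 2 / X"
    proof (rule eventually_at_top_linorderI[of 1])
      fix X :: real assume X: "X \<ge> 1"
      let ?c = "real (card {D \<in> nonsquares e X. M dvd D + r})"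
      have "?c / X - 1 / of_int M = (?c - X / of_int M) / X" using X by (simp add: field_simps)
      then have "norm (?c / X - 1 / of_int M) = \<bar>?c - X / of_int M\<bar> / X" using X by simp
      also have "\<dots> \<le> (sqrt X + 2) / X"
        using card_nonsquares_progression[OF assms, of X r] X by (intro divide_right_mono) auto
      also have "\<dots> = 1 / sqrt X + 2 / X" using X by (simp add: add_divide_distrib sqrt_divide_self_eq inverse_eq_divide)
      finally show "norm (?c / X - 1 / of_int M) \<le> 1 / sqrt X + 2 / X" .
    qed
    have "((\<lambda>X::real. 1 / sqrt X) \<longlongrightarrow> 0) at_top"
      by (rule tendsto_divide_0[OF tendsto_const]) (simp add: filterlim_at_top_imp_at_infinity sqrt_at_top)
    moreover have "((\<lambda>X::real. 2 / X) \<longlongrightarrow> 0) at_top"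
      by (rule tendsto_divide_0[OF tendsto_const]) (simp add: filterlim_at_top_imp_at_infinity filterlim_ident)
    ultimately show "((\<lambda>X::real. 1 / sqrt X + 2 / X) \<longlongrightarrow> 0) at_top"
      using tendsto_add by fastforce
  qed
  then show ?thesis by (simp add: LIM_zero_iff)
qed

definition discs :: "int \<Rightarrow> real \<Rightarrow> int set" where
  "discs e X = {D \<in> nonsquares e X. D mod 4 = 0 \<or> D mod 4 = 1}"

lemma finite_discs: "\<bar>e\<bar> = 1 \<Longrightarrow> finite (discs e X)"
  by (simp add: discs_def finite_nonsquares)

lemma density_discs:
  assumes "\<bar>e\<bar> = 1"
  shows "((\<lambda>X. real (card (discs e X)) / X) \<longlongrightarrow> 1 / 2) at_top"
proof -
  have "discs e X = {D \<in> nonsquares e X. 4 dvd D + 0} \<union> {D \<in> nonsquares e X. 4 dvd D + 3}" for X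
    unfolding discs_def by auto presburger+
  then have "card (discs e X) = card {D \<in> nonsquares e X. 4 dvd D + 0} + card {D \<in> nonsquares e X. 4 dvd D + 3}" for X
    by (simp only:) (rule card_Un_disjoint; use finite_nonsquares[OF assms] in \<open>auto; presburger\<close>)
  then have "real (card (discs e X)) / X = real (card {D \<in> nonsquares e X. 4 dvd D + 0}) / X
      + real (card {D \<in> nonsquares e X. 4 dvd D + 3}) / X" for X
    by (simp add: add_divide_distrib)
  moreover have "((\<lambda>X. real (card {D \<in> nonsquares e X. 4 dvd D + 0}) / X
      + real (card {D \<in> nonsquares e X. 4 dvd D + 3}) / X) \<longlongrightarrow> 1 / of_int 4 + 1 / of_int 4) at_top"
    by (intro tendsto_add density_nonsquares_progression assms) auto
  ultimately show ?thesis by simp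
qed

section \<open>Coprime residues and divisors\<close>

lemma card_coprime_below_double:
  fixes m :: nat
  shows "card {s. s < 2 * m \<and> coprime s m} = 2 * totient m"
\<comment> \<open>For \<open>m = 1\<close> the set \<open>totatives m\<close> is {1}, while the
  residues below \<open>m\<close> are {0}; hence the separate case.\<close>
proof (cases "m \<le> 1")
  case True
  then consider "m = 0" | "m = 1" by linarith
  then show ?thesis
  proof cases
    case 2
    have "{s. s < 2 * (1::nat) \<and> coprime s 1} = {0, 1}" by auto
    then show ?thesis using 2 by simp
  qed simp
next
  case False
  define T where "T = {s. s < m \<and> coprime s m}"
  have shift: "coprime (r + m) m \<longleftrightarrow> coprime r m" for r
    unfolding coprime_iff_gcd_eq_1 by (simp only: gcd_add1)
  have t: "T = totatives m"
    using False unfolding T_def by (auto simp: totatives_def intro!: Nat.gr0I le_neq_trans)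
  have fin: "finite T" unfolding t by simp
  have "{s. s < 2 * m \<and> coprime s m} = T \<union> (\<lambda>s. s + m) ` T"
  proof (intro equalityI subsetI)
    fix s assume s: "s \<in> {s. s < 2 * m \<and> coprime s m}"
    show "s \<in> T \<union> (\<lambda>s. s + m) ` T"
    proof (cases "s < m")
      case False
      then obtain r where r: "s = r + m" by (metis add.commute le_Suc_ex not_less)
      then have "r < m" "coprime r m" using s shift by simp_all
      then show ?thesis using r unfolding T_def by blast
    qed (use s T_def in simp)
  next
    fix s assume "s \<in> T \<union> (\<lambda>s. s + m) ` T"
    then consider "s < m" "coprime s m" | r where "s = r + m" "r < m" "coprime r m"
      unfolding T_def by blast
    then show "s \<in> {s. s < 2 * m \<and> coprime s m}"
      by cases (simp_all add: shift)
  qed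
  also have "card \<dots> = card T + card ((\<lambda>s. s + m) ` T)"
  proof (rule card_Un_disjoint)
    show "T \<inter> (\<lambda>s. s + m) ` T = {}" unfolding T_def by fastforce
  qed (use fin in simp_all)
  also have "card ((\<lambda>s. s + m) ` T) = card T"
    by (rule card_image) (simp add: inj_on_def)
  finally show ?thesis by (simp add: t totient_def)
qed

text \<open>Of d and m / d one is at most sqrt m, so the divisors are covered by two sets of at most
  floor (sqrt m) elements.\<close>

lemma card_divisors_le_sqrt:
  fixes m :: nat
  assumes "m > 0"
  shows "real (card {d. d dvd m}) \<le> 2 * sqrt (real m)"
proof -
  define f where "f = nat \<lfloor>sqrt (real m)\<rfloor>"
  have "{d. d dvd m} \<subseteq> {1..f} \<union> (\<lambda>d. m div d) ` {1..f}"
  proof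
    fix d assume "d \<in> {d. d dvd m}"
    then obtain c where c: "m = d * c" by auto
    have pos: "d > 0" "c > 0" using c assms by auto
    show "d \<in> {1..f} \<union> (\<lambda>d. m div d) ` {1..f}"
    proof (cases "d \<le> c")
      case True
      then have "d\<^sup>2 \<le> m" by (simp add: c power2_eq_square)
      then have "(real d)\<^sup>2 \<le> real m" by (metis of_nat_le_iff of_nat_power)
      then have "real d \<le> sqrt (real m)" by (rule real_le_rsqrt)
      then have "d \<le> f" unfolding f_def by (simp add: le_nat_floor)
      then show ?thesis using pos by auto
    next
      case False
      then have "c\<^sup>2 \<le> m" by (simp add: c power2_eq_square)
      then have "(real c)\<^sup>2 \<le> real m" by (metis of_nat_le_iff of_nat_power)
      then have "real c \<le> sqrt (real m)" by (rule real_le_rsqrt)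
      then have "c \<in> {1..f}" unfolding f_def using pos by (simp add: le_nat_floor)
      moreover have "d = m div c" using c pos by simp
      ultimately show ?thesis by blast
    qed
  qed
  then have "card {d. d dvd m} \<le> card ({1..f} \<union> (\<lambda>d. m div d) ` {1..f})"
    by (intro card_mono) auto
  also have "\<dots> \<le> f + f"
    using card_Un_le[of "{1..f}" "(\<lambda>d. m div d) ` {1..f}"] card_image_le[of "{1..f}" "\<lambda>d. m div d"] by simp
  finally have "real (card {d. d dvd m}) \<le> 2 * real f" by linarith
  moreover have "real f \<le> sqrt (real m)" unfolding f_def by simp
  ultimately show ?thesis by linarith
qed

section \<open>Counting pairs\<close>

text \<open>These pairs index the torsion ideals of the order of discriminant \<open>D\<close>. The
  bound on \<open>s\<close> picks one representative of each class modulo \<open>2 * m\<close> and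
  at the same time excludes \<open>m = 0\<close>.\<close>

definition param_set :: "int \<Rightarrow> (nat \<times> nat) set" where
  "param_set D = {(m, s). s < 2 * m \<and> coprime s m \<and> int (4 * m ^ 3) dvd D + int (3 * m\<^sup>2 * s\<^sup>2)}"

text \<open>The same data sorted by the level \<open>m\<close>. It suffices to let \<open>D\<close>
  run over nonsquares, because the condition modulo 4 is automatic by
  \<open>disc_of_param\<close>.\<close>

definition level_set :: "int \<Rightarrow> real \<Rightarrow> nat \<Rightarrow> (nat \<times> int) set" where
  "level_set e X m = (SIGMA s:{s. s < 2 * m \<and> coprime s m}.
     {D \<in> nonsquares e X. int (4 * m ^ 3) dvd D + int (3 * m\<^sup>2 * s\<^sup>2)})"

lemma square_dvd_of_param:
  assumes "int (4 * m ^ 3) dvd D + int (3 * m\<^sup>2 * s\<^sup>2)"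
  shows "int m ^ 2 dvd D"
proof -
  have "int m ^ 2 dvd int (4 * m ^ 3)" by (simp add: power3_eq_cube power2_eq_square)
  then have "int m ^ 2 dvd D + int (3 * m\<^sup>2 * s\<^sup>2)" using assms dvd_trans by blast
  moreover have "int m ^ 2 dvd int (3 * m\<^sup>2 * s\<^sup>2)" by simp
  ultimately show ?thesis by (simp add: dvd_add_left_iff)
qed

text \<open>A crude bound that makes the sums over levels finite.\<close>

lemma level_le_abs:
  assumes "int m ^ 2 dvd D" "D \<noteq> 0"
  shows "int m \<le> \<bar>D\<bar>"
proof -
  have "int m ^ 2 \<le> \<bar>D\<bar>" using dvd_imp_le_int[OF assms(2,1)] by simp
  moreover have "int m \<le> int m ^ 2" by (simp add: power2_eq_square flip: of_nat_mult)
  ultimately show ?thesis by linarith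
qed

lemma finite_param_set:
  assumes "D \<noteq> 0"
  shows "finite (param_set D)"
proof (rule finite_subset)
  have "m \<le> nat \<bar>D\<bar>" if "(m, s) \<in> param_set D" for m s
    using that square_dvd_of_param[of m D s] level_le_abs[of m D] assms by (auto simp: param_set_def)
  then show "param_set D \<subseteq> {..nat \<bar>D\<bar>} \<times> {..2 * nat \<bar>D\<bar>}"
    by (fastforce simp: param_set_def)
qed simp

text \<open>Modulo 4 the divisibility reads D = -3 (m s)^2 = (m s)^2, and squares are 0 or 1 modulo
  4.\<close>

lemma disc_of_param:
  assumes "int (4 * m ^ 3) dvd D + int (3 * m\<^sup>2 * s\<^sup>2)"
  shows "D mod 4 = 0 \<or> D mod 4 = 1"
proof -
  have "(4::int) dvd int (4 * m ^ 3)" by simp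
  then have "4 dvd D + 3 * (int (m * s))\<^sup>2"
    using assms dvd_trans by (fastforce simp: power_mult_distrib mult.assoc)
  moreover have "(int (m * s))\<^sup>2 mod 4 = 0 \<or> (int (m * s))\<^sup>2 mod 4 = 1"
  proof (cases "even (m * s)")
    case True
    then obtain k where "m * s = 2 * k" by auto
    then have "(int (m * s))\<^sup>2 = 4 * (int k)\<^sup>2" by (simp add: power2_eq_square)
    then show ?thesis by simp
  next
    case False
    then obtain k where "m * s = 2 * k + 1" using oddE by blast
    then have "(int (m * s))\<^sup>2 = 4 * (int k * int k + int k) + 1" by (simp add: power2_eq_square algebra_simps)
    then show ?thesis by simp presburger?
  qed
  ultimately show ?thesis by presburger
qed

lemma finite_level_set: "\<bar>e\<bar> = 1 \<Longrightarrow> finite (level_set e X m)"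
  by (auto simp: level_set_def finite_nonsquares)

text \<open>Double counting of the triples (D, m, s); a level m that occurs satisfies m <= |D| < X,
  so the cutoff \<open>K\<close> loses nothing.\<close>

lemma sum_card_param_set:
  assumes e: "\<bar>e\<bar> = 1" and K: "X \<le> real K"
  shows "(\<Sum>D\<in>discs e X. card (param_set D)) = (\<Sum>m<K. card (level_set e X m))"
proof -
  have nz: "D \<noteq> 0" if "D \<in> discs e X" for D using that by (auto simp: discs_def nonsquares_def)
  have "(\<Sum>D\<in>discs e X. card (param_set D)) = card (SIGMA D:discs e X. param_set D)"
    using e nz by (simp add: finite_discs finite_param_set)
  also have "\<dots> = card (SIGMA m:{..<K}. level_set e X m)"
  proof (rule bij_betw_same_card)
    show "bij_betw (\<lambda>(D, m, s). (m, s, D)) (SIGMA D:discs e X. param_set D) (SIGMA m:{..<K}. level_set e X m)"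
    proof (rule bij_betw_byWitness[where f' = "\<lambda>(m, s, D). (D, m, s)"])
      have "m < K" if "D \<in> discs e X" "(m, s) \<in> param_set D" for m s D
      proof -
        have "int m \<le> \<bar>D\<bar>"
          using that nz square_dvd_of_param[of m D s] level_le_abs[of m D] by (auto simp: param_set_def)
        moreover have "\<bar>D\<bar> = e * D" using that e by (auto simp: discs_def nonsquares_def abs_if split: if_splits)
        moreover have "of_int (e * D) < X" using that by (simp add: discs_def nonsquares_def)
        ultimately show ?thesis using K by linarith
      qed
      then show "(\<lambda>(D, m, s). (m, s, D)) ` (SIGMA D:discs e X. param_set D) \<subseteq> (SIGMA m:{..<K}. level_set e X m)"
        by (fastforce simp: level_set_def param_set_def discs_def
            simp del: of_nat_mult of_nat_power of_nat_numeral)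
      show "(\<lambda>(m, s, D). (D, m, s)) ` (SIGMA m:{..<K}. level_set e X m) \<subseteq> (SIGMA D:discs e X. param_set D)"
        using disc_of_param by (auto simp: level_set_def param_set_def discs_def)
    qed auto
  qed
  also have "\<dots> = (\<Sum>m<K. card (level_set e X m))"
    using e by (simp add: finite_level_set)
  finally show ?thesis .
qed

lemma level_set_empty:
  assumes e: "\<bar>e\<bar> = 1" and "X \<le> real m"
  shows "level_set e X m = {}"
proof (rule ccontr)
  assume "level_set e X m \<noteq> {}"
  then obtain s D where D: "D \<in> nonsquares e X" "int (4 * m ^ 3) dvd D + int (3 * m\<^sup>2 * s\<^sup>2)"
    by (auto simp: level_set_def)
  have "D \<noteq> 0" using D by (auto simp: nonsquares_def)
  then have "int m \<le> \<bar>D\<bar>" using D square_dvd_of_param level_le_abs by blast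
  moreover have "\<bar>D\<bar> = e * D" using D e by (auto simp: nonsquares_def abs_if split: if_splits)
  moreover have "of_int (e * D) < X" using D by (simp add: nonsquares_def)
  ultimately show False using assms by linarith
qed

text \<open>Tannery's theorem asks for a series whose index set does not depend on \<open>X\<close>;
  the added terms vanish.\<close>

lemma sum_card_param_set_suminf:
  assumes "\<bar>e\<bar> = 1"
  shows "real (\<Sum>D\<in>discs e X. card (param_set D)) = (\<Sum>m. real (card (level_set e X m)))"
proof -
  obtain K where K: "X \<le> real K" using real_arch_simple by blast
  have "(\<Sum>m. real (card (level_set e X m))) = (\<Sum>m<K. real (card (level_set e X m)))"
  proof (rule suminf_finite)
    fix m assume "m \<notin> {..<K}"
    then have "X \<le> real m" using K by simp
    then show "real (card (level_set e X m)) = 0" using level_set_empty[OF assms] by simp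
  qed simp
  then show ?thesis using sum_card_param_set[OF assms K] by simp
qed

text \<open>Each of the \<open>2 * totient m\<close> admissible \<open>s\<close> contributes one
  residue class modulo \<open>4 * m ^ 3\<close>. For \<open>m = 0\<close> both sides are 0, as
  division by zero gives 0.\<close>

lemma density_level_set:
  assumes "\<bar>e\<bar> = 1"
  shows "((\<lambda>X. real (card (level_set e X m)) / X) \<longlongrightarrow> real (totient m) / (2 * real m ^ 3)) at_top"
proof (cases "m = 0")
  case True
  then show ?thesis by (simp add: level_set_def)
next
  case False
  let ?S = "{s. s < 2 * m \<and> coprime s m}"
  have fin: "finite ?S" by simp
  have "real (card (level_set e X m)) / X =
    (\<Sum>s\<in>?S. real (card {D \<in> nonsquares e X. int (4 * m ^ 3) dvd D + int (3 * m\<^sup>2 * s\<^sup>2)}) / X)" for X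
    unfolding level_set_def
    by (subst card_SigmaI) (use fin assms in \<open>auto simp: finite_nonsquares sum_divide_distrib\<close>)
  moreover have "((\<lambda>X. \<Sum>s\<in>?S. real (card {D \<in> nonsquares e X. int (4 * m ^ 3) dvd D + int (3 * m\<^sup>2 * s\<^sup>2)}) / X)
     \<longlongrightarrow> (\<Sum>s\<in>?S. 1 / of_int (int (4 * m ^ 3)))) at_top"
    by (intro tendsto_sum density_nonsquares_progression assms) (use False in simp)
  moreover have "(\<Sum>s\<in>?S. 1 / of_int (int (4 * m ^ 3))) = real (totient m) / (2 * real m ^ 3)"
    by (simp add: card_coprime_below_double)
  ultimately show ?thesis by (simp only:)
qed

section \<open>A bound for the levels that is uniform in X\<close>

text \<open>Fix a solution s0. For a solution s, m divides 3 (s - s0)(s + s0); with d = gcd(s - s0,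
  m) and c = m / d this gives c | 3 (s + s0). If s and r have the same d, then d | s - r and c | 3
  (s - r). A common divisor of d and c divides 6 s0, hence 6 because s0 is coprime to m, and so m |
  18 (s - r). Thus d determines 18 s modulo m, and 18 s < 36 m leaves at most 36 quotients, which is
  the constant.\<close>

lemma card_roots_le:
  assumes m: "m > 0"
  shows "card {s. s < 2 * m \<and> coprime s m \<and> int (4 * m ^ 3) dvd D + int (3 * m\<^sup>2 * s\<^sup>2)} \<le> 36 * card {d. d dvd m}"
    (is "card ?S \<le> _")
proof (cases "?S = {}")
  case False
  then obtain s0 where s0: "s0 \<in> ?S" by blast
  define g where "g s = nat (gcd (int s - int s0) (int m))" for s
  have m_dvd: "int m dvd 3 * ((int s - int s0) * (int s + int s0))" if "s \<in> ?S" for s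
  proof -
    have "int (4 * m ^ 3) dvd (D + int (3 * m\<^sup>2 * s\<^sup>2)) - (D + int (3 * m\<^sup>2 * s0\<^sup>2))"
      using that s0 by (intro dvd_diff) auto
    also have "\<dots> = int m ^ 2 * (3 * ((int s - int s0) * (int s + int s0)))"
      by (simp add: algebra_simps power2_eq_square)
    finally have "int m ^ 2 * (4 * int m) dvd int m ^ 2 * (3 * ((int s - int s0) * (int s + int s0)))"
      by (simp add: power3_eq_cube power2_eq_square mult_ac)
    then have "4 * int m dvd 3 * ((int s - int s0) * (int s + int s0))"
      using m by (metis dvd_times_left_cancel_iff of_nat_0_less_iff order_less_irrefl zero_less_power)
    then show ?thesis using dvd_mult_right by blast
  qed
  have "inj_on (\<lambda>s. (g s, 18 * s div m)) ?S"
  proof (rule inj_onI)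
    fix s r assume s: "s \<in> ?S" and r: "r \<in> ?S"
      and eq: "(g s, 18 * s div m) = (g r, 18 * r div m)"
    define d where "d = gcd (int s - int s0) (int m)"
    have d': "d = gcd (int r - int s0) (int m)"
      using eq by (simp add: g_def d_def eq_nat_nat_iff)
    have dpos: "d > 0" using m by (simp add: d_def)
    obtain c where c: "int m = d * c" using d_def by (metis gcd_dvd2 dvdE)
    have c_dvd: "c dvd 3 * (int t + int s0)" if t: "t \<in> ?S" "d = gcd (int t - int s0) (int m)" for t
    proof -
      obtain a where a: "int t - int s0 = d * a" using t by (metis gcd_dvd1 dvdE)
      have "coprime a c"
      proof -
        have "gcd (d * a) (d * c) = d" using t(2) a c by simp
        then have "d * gcd a c = d" using dpos by (simp add: gcd_mult_distrib_int[symmetric])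
        then show ?thesis using dpos by (simp add: coprime_iff_gcd_eq_1)
      qed
      moreover have "d * c dvd d * (a * (3 * (int t + int s0)))"
        using m_dvd[OF t(1)] unfolding a c by (simp add: mult_ac)
      then have "c dvd a * (3 * (int t + int s0))" using dpos by simp
      ultimately show ?thesis using coprime_dvd_mult_right_iff coprime_commute by blast
    qed
    have "d dvd int s - int s0" "d dvd int r - int s0" by (simp add: d_def, simp add: d')
    then have 1: "d dvd int s - int r" using dvd_diff[of d "int s - int s0" "int r - int s0"] by simp
    have "c dvd 3 * (int s + int s0) - 3 * (int r + int s0)"
      using c_dvd s r d_def d' by (intro dvd_diff) auto
    then have 2: "c dvd 3 * (int s - int r)" by (simp add: algebra_simps)
    define h where "h = gcd d c"
    have "h dvd 6"
    proof -
      have "h dvd int s - int s0" using \<open>d dvd int s - int s0\<close> h_def by (meson gcd_dvd1 dvd_trans)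
      moreover have "h dvd 3 * (int s + int s0)" using c_dvd[OF s d_def] h_def by (meson gcd_dvd2 dvd_trans)
      ultimately have "h dvd 3 * (int s + int s0) - 3 * (int s - int s0)" by (meson dvd_diff dvd_mult)
      then have "h dvd int s0 * 6" by (simp add: algebra_simps)
      moreover have "h dvd int m" using c h_def by simp
      moreover have "coprime (int m) (int s0)" using s0 by (simp add: coprime_commute)
      then have "coprime h (int s0)"
        by (rule coprime_divisors[OF \<open>h dvd int m\<close> dvd_refl])
      ultimately show ?thesis using coprime_dvd_mult_right_iff by blast
    qed
    \<comment> \<open>As \<open>d\<close> and \<open>c\<close> need not be coprime, their both
      dividing \<open>x\<close> only gives d c | x gcd(d, c).\<close>
    define x where "x = 3 * (int s - int r)"
    have "c dvd x" "d dvd x" using 1 2 unfolding x_def by (simp_all only: dvd_mult)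
    then have "c * d dvd x * d" "d * c dvd x * c" by (simp_all only: mult_dvd_mono dvd_refl)
    then have "d * c dvd x * d" "d * c dvd x * c" by (simp_all only: mult.commute[of c d])
    then have "d * c dvd gcd (x * d) (x * c)" by (rule gcd_greatest)
    also have "gcd (x * d) (x * c) = \<bar>x\<bar> * h"
      unfolding h_def by (rule gcd_mult_distrib_int[symmetric])
    also have "\<dots> dvd x * 6" using \<open>h dvd 6\<close> by (intro mult_dvd_mono) auto
    also have "x * 6 = 18 * int s - 18 * int r" by (simp add: x_def)
    finally have "int m dvd 18 * int s - 18 * int r" unfolding c .
    then have "(18 * int s) mod int m = (18 * int r) mod int m" by (simp add: mod_eq_dvd_iff)
    then have "int (18 * s mod m) = int (18 * r mod m)" by (simp add: zmod_int)
    then have "(18 * s) mod m = (18 * r) mod m" by (simp only: of_nat_eq_iff)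
    moreover have "(18 * s) div m = (18 * r) div m" using eq by simp
    ultimately have "18 * s = 18 * r" by (metis div_mult_mod_eq)
    then show "s = r" by simp
  qed
  moreover have "(\<lambda>s. (g s, 18 * s div m)) ` ?S \<subseteq> {d. d dvd m} \<times> {..<36}"
  proof -
    have "g s dvd m" for s unfolding g_def by (metis gcd_dvd2 gcd_ge_0_int int_dvd_int_iff int_nat_eq)
    moreover have "18 * s div m < 36" if "s < 2 * m" for s
      using that m by (simp add: less_mult_imp_div_less)
    ultimately show ?thesis by auto
  qed
  ultimately have "card ?S \<le> card ({d. d dvd m} \<times> {..<(36::nat)})"
    using m by (intro card_inj_on_le) auto
  then show ?thesis by (simp add: card_cartesian_product mult.commute)
next
  case True
  then show ?thesis by (simp only: card.empty zero_le)
qed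

text \<open>There is no additive constant because 0 is not counted. So the bound stays of the right
  size even when \<open>M\<close> exceeds \<open>X\<close>.\<close>

lemma card_multiples_le:
  fixes M e :: int
  assumes "M > 0" "\<bar>e\<bar> = 1" "X \<ge> 0"
  shows "real (card {D \<in> nonsquares e X. M dvd D}) \<le> X / of_int M"
proof -
  have ee: "e * (e * D) = D" for D
    using assms(2) by (auto simp: abs_if split: if_splits)
  have "{D \<in> nonsquares e X. M dvd D} \<subseteq> (\<lambda>j. e * (M * j)) ` {1..\<lfloor>X / of_int M\<rfloor>}"
  proof
    fix D assume D: "D \<in> {D \<in> nonsquares e X. M dvd D}"
    then have "M dvd e * D" by simp
    then obtain j where j: "e * D = M * j" by auto
    have p: "0 < e * D" "of_int (e * D) < X" using D by (auto simp: nonsquares_def)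
    then have "0 < j" using j assms by (simp add: zero_less_mult_iff)
    moreover have "of_int M * of_int j < X" using p(2) unfolding j by simp
    then have "of_int j \<le> X / of_int M" using assms by (simp add: field_simps)
    ultimately have "j \<in> {1..\<lfloor>X / of_int M\<rfloor>}" by (simp add: le_floor_iff)
    moreover have "D = e * (M * j)" using ee[of D] j by simp
    ultimately show "D \<in> (\<lambda>j. e * (M * j)) ` {1..\<lfloor>X / of_int M\<rfloor>}" by blast
  qed
  then have "card {D \<in> nonsquares e X. M dvd D} \<le> card {1..\<lfloor>X / of_int M\<rfloor>}"
    by (meson card_image_le card_mono finite_atLeastAtMost_int finite_imageI le_trans)
  then have "real (card {D \<in> nonsquares e X. M dvd D}) \<le> real (nat \<lfloor>X / of_int M\<rfloor>)" by simp
  also have "\<dots> \<le> X / of_int M" using assms by simp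
  finally show ?thesis .
qed

text \<open>The pairs are fibred over \<open>D\<close> and not over \<open>s\<close>: at most X /
  m^2 values of \<open>D\<close> are multiples of m^2, and over each lie at most 36 * 2 sqrt m
  values of \<open>s\<close>. For \<open>m = 0\<close> the set is empty.\<close>

lemma card_level_set_le:
  assumes e: "\<bar>e\<bar> = 1" and X: "X > 0"
  shows "real (card (level_set e X m)) / X \<le> 72 * real m powr (-3/2)"
proof (cases "m = 0")
  case True
  then show ?thesis by (simp add: level_set_def)
next
  case False
  let ?R = "\<lambda>D. {s. s < 2 * m \<and> coprime s m \<and> int (4 * m ^ 3) dvd D + int (3 * m\<^sup>2 * s\<^sup>2)}"
  let ?N = "{D \<in> nonsquares e X. int m ^ 2 dvd D}"
  have finN: "finite ?N" using finite_nonsquares[OF e] by simp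
  have "card (level_set e X m) = card (SIGMA D:?N. ?R D)"
  proof (rule bij_betw_same_card)
    show "bij_betw prod.swap (level_set e X m) (SIGMA D:?N. ?R D)"
      by (rule bij_betw_byWitness[where f' = prod.swap])
        (auto simp: level_set_def simp del: of_nat_mult of_nat_power of_nat_numeral dest: square_dvd_of_param)
  qed
  also have "\<dots> = (\<Sum>D\<in>?N. card (?R D))" using finN by (subst card_SigmaI) auto
  also have "\<dots> \<le> (\<Sum>D\<in>?N. 36 * card {d. d dvd m})"
    by (rule sum_mono) (use card_roots_le False in blast)
  finally have "card (level_set e X m) \<le> card ?N * (36 * card {d. d dvd m})" by simp
  then have "real (card (level_set e X m)) \<le> real (card ?N) * (36 * real (card {d. d dvd m}))"
    by (metis of_nat_le_iff of_nat_mult of_nat_numeral)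
  also have "\<dots> \<le> (X / real m ^ 2) * (36 * (2 * sqrt (real m)))"
    using card_multiples_le[of "int m ^ 2" e X] card_divisors_le_sqrt[of m] False e X
    by (intro mult_mono) auto
  finally have "real (card (level_set e X m)) / X \<le> 72 * (sqrt (real m) / real m ^ 2)"
    using X by (simp add: field_simps)
  also have "sqrt (real m) / real m ^ 2 = real m powr (-3/2)"
  proof -
    have "sqrt (real m) / real m ^ 2 = real m powr (1/2) / real m powr 2"
      using False by (simp add: powr_half_sqrt powr_numeral)
    also have "\<dots> = real m powr (1/2 - 2)" by (simp only: powr_diff)
    also have "\<dots> = real m powr (-3/2)" by simp
    finally show ?thesis .
  qed
  finally show ?thesis .
qed

lemma sum_param_set_asymp:
  assumes e: "\<bar>e\<bar> = 1"
  shows "((\<lambda>X. real (\<Sum>D\<in>discs e X. card (param_set D)) / X) \<longlongrightarrow> (\<Sum>m. real (totient m) / (2 * real m ^ 3))) at_top"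
proof -
  have "((\<lambda>X. \<Sum>m. real (card (level_set e X m)) / X) \<longlongrightarrow> (\<Sum>m. real (totient m) / (2 * real m ^ 3))) at_top"
  proof (rule tannerys_theorem[THEN conjunct2, THEN conjunct2])
    show "((\<lambda>X. real (card (level_set e X m)) / X) \<longlongrightarrow> real (totient m) / (2 * real m ^ 3)) at_top" for m
      by (rule density_level_set[OF e])
    show "\<forall>\<^sub>F (m, X) in at_top \<times>\<^sub>F at_top. norm (real (card (level_set e X m)) / X) \<le> 72 * real m powr (-3/2)"
      unfolding eventually_prod_filter case_prod_conv
      by (intro exI[of _ "\<lambda>_. True"] exI[of _ "\<lambda>X. X > 0"])
        (use card_level_set_le[OF e] eventually_gt_at_top[of "0::real"] in auto)
    show "summable (\<lambda>m. 72 * real m powr (-3/2))"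
      by (intro summable_mult) (simp add: summable_real_powr_iff)
  qed simp
  moreover have "(\<Sum>m. real (card (level_set e X m)) / X) = real (\<Sum>D\<in>discs e X. card (param_set D)) / X" for X
    unfolding sum_card_param_set_suminf[OF e]
  proof (rule suminf_divide)
    obtain K where K: "X \<le> real K" using real_arch_simple by blast
    show "summable (\<lambda>m. real (card (level_set e X m)))"
    proof (rule summable_finite[of "{..<K}"])
      fix m assume "m \<notin> {..<K}"
      then have "X \<le> real m" using K by simp
      then show "real (card (level_set e X m)) = 0" using level_set_empty[OF e] by simp
    qed simp
  qed
  ultimately show ?thesis by simp
qed

section \<open>The average of the counting function\<close>

text \<open>The unconditional form \<open>has_sum\<close> allows the later regrouping of double sums
  by divisors.\<close>

lemma has_sum_zeta:
  assumes "s > 1"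
  shows "((\<lambda>n. 1 / real n powr s) has_sum zeta s) {0<..}"
proof -
  have "summable (\<lambda>n. real n powr (- s))" using assms by (simp add: summable_real_powr_iff)
  then have "summable (\<lambda>n. 1 / real (Suc n) powr s)"
    by (subst (asm) summable_Suc_iff[symmetric]) (simp add: powr_minus_divide)
  then have "(\<lambda>n. 1 / real (Suc n) powr s) sums zeta s"
    by (simp only: zeta_def summable_sums)
  then have "((\<lambda>n. 1 / real (Suc n) powr s) has_sum zeta s) UNIV"
    by (rule sums_nonneg_imp_has_sum) simp
  moreover have "bij_betw Suc UNIV {0<..}"
    by (rule bij_betwI[where g = "\<lambda>n. n - 1"]) auto
  ultimately show ?thesis
    using has_sum_reindex_bij_betw[of Suc UNIV "{0<..}" "\<lambda>n. 1 / real n powr s"] by simp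
qed

text \<open>The term n = 1 alone contributes 1.\<close>

lemma zeta_pos:
  assumes "s > 1"
  shows "zeta s > 0"
proof -
  have "((\<lambda>n. 1 / real n powr s) has_sum 1) {1}"
    using has_sum_finite[of "{1::nat}" "\<lambda>n. 1 / real n powr s"] by simp
  then have "1 \<le> zeta s"
    by (rule has_sum_mono2[OF _ has_sum_zeta[OF assms]]) auto
  then show ?thesis by simp
qed

text \<open>The Dirichlet series of Euler's function is multiplied with that of the constant \<open>1\<close>,
  and the double sum is grouped by the product of the two indices.\<close>
lemma suminf_totient_cubes:
  "(\<Sum>m. real (totient m) / (2 * real m ^ 3)) = zeta 2 / zeta 3 / 2"
proof -
  \<comment> \<open>The terms of the product of the series of phi(d)/d^3 and of 1/k^3.\<close>
  define F :: "nat \<times> nat \<Rightarrow> real" where "F = (\<lambda>(d, k). real (totient d) / real (d * k) ^ 3)"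
  let ?P = "{0<..} :: nat set"
  have z3: "((\<lambda>n. 1 / real n ^ 3) has_sum zeta 3) ?P"
    using has_sum_zeta[of 3] by (rule has_sum_cong[THEN iffD1, rotated]) (simp_all add: powr_numeral)
  have z2: "((\<lambda>n. 1 / real n ^ 2) has_sum zeta 2) ?P"
    using has_sum_zeta[of 2] by (rule has_sum_cong[THEN iffD1, rotated]) (simp_all add: powr_numeral)
  have "(\<lambda>d. real (totient d) / real d ^ 3) summable_on ?P"
  proof (rule summable_on_comparison_test)
    show "(\<lambda>n. 1 / real n ^ 2) summable_on ?P" using z2 by (rule has_sum_imp_summable)
    show "real (totient d) / real d ^ 3 \<le> 1 / real d ^ 2" if "d \<in> ?P" for d
    proof -
      have "real (totient d) / real d ^ 3 \<le> real d / real d ^ 3"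
        by (intro divide_right_mono) (auto simp: totient_le)
      also have "\<dots> = 1 / real d ^ 2" using that by (simp add: power2_eq_square power3_eq_cube)
      finally show ?thesis .
    qed
  qed auto
  then obtain T where T: "((\<lambda>d. real (totient d) / real d ^ 3) has_sum T) ?P"
    by (auto simp: summable_on_def)
  have inner: "((\<lambda>k. F (d, k)) has_sum (real (totient d) / real d ^ 3 * zeta 3)) ?P" for d
    using has_sum_cmult_right[OF z3, of "real (totient d) / real d ^ 3"]
    by (simp add: F_def power_mult_distrib)
  have outer: "((\<lambda>d. real (totient d) / real d ^ 3 * zeta 3) has_sum (T * zeta 3)) ?P"
    by (rule has_sum_cmult_left[OF T])
  have "F summable_on (?P \<times> ?P)"
    by (rule summable_on_SigmaI[OF inner has_sum_imp_summable[OF outer]]) (auto simp: F_def)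
  then have F1: "(F has_sum (T * zeta 3)) (?P \<times> ?P)"
    by (intro has_sum_SigmaI[OF inner outer])
  have bij: "bij_betw (\<lambda>(n, d). (d, n div d)) (SIGMA n:?P. {d. d dvd n}) (?P \<times> ?P)"
    by (rule bij_betw_byWitness[where f' = "\<lambda>(d, k). (d * k, d)"])
      (auto simp: dvd_div_eq_0_iff intro!: Nat.gr0I)
  have "((\<lambda>x. F (case x of (n, d) \<Rightarrow> (d, n div d))) has_sum (T * zeta 3)) (SIGMA n:?P. {d. d dvd n})"
    using F1 by (subst has_sum_reindex_bij_betw[OF bij])
  then have "((\<lambda>n. 1 / real n ^ 2) has_sum (T * zeta 3)) ?P"
  proof (rule has_sum_SigmaD)
    fix n :: nat assume n: "n \<in> ?P"
    \<comment> \<open>By Gauss's identity the totients of the divisors of n add up to n, so the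
      fibre over n = d k has sum n / n^3.\<close>
    have "(\<Sum>d | d dvd n. F (d, n div d)) = (\<Sum>d | d dvd n. real (totient d) / real n ^ 3)"
      by (rule sum.cong) (auto simp: F_def simp del: of_nat_mult)
    also have "\<dots> = real (\<Sum>d | d dvd n. totient d) / real n ^ 3"
      by (simp add: sum_divide_distrib)
    also have "\<dots> = 1 / real n ^ 2"
      using n by (simp add: totient_divisor_sum power2_eq_square power3_eq_cube del: of_nat_sum)
    finally show "((\<lambda>d. F (case (n, d) of (n, d) \<Rightarrow> (d, n div d))) has_sum 1 / real n ^ 2) {d. d dvd n}"
      using n has_sum_finite[of "{d. d dvd n}" "\<lambda>d. F (d, n div d)"] by simp
  qed
  then have "T * zeta 3 = zeta 2" using z2 has_sum_unique by blast
  then have "T = zeta 2 / zeta 3" using zeta_pos[of 3] by (simp add: field_simps)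
  moreover have "((\<lambda>d. real (totient d) / real d ^ 3) has_sum T) UNIV"
    using T by (rule has_sum_cong_neutral[THEN iffD1, rotated -1]) auto
  then have "(\<lambda>m. real (totient m) / real m ^ 3) sums T" by (rule has_sum_imp_sums)
  then have "(\<lambda>m. real (totient m) / real m ^ 3 / 2) sums (T / 2)" by (rule sums_divide)
  ultimately show ?thesis by (simp add: sums_iff mult.commute)
qed

theorem average_card_param_set:
  assumes e: "\<bar>e\<bar> = 1"
  shows "((\<lambda>X. (\<Sum>D\<in>discs e X. real (card (param_set D))) / real (card (discs e X))) \<longlongrightarrow> zeta 2 / zeta 3) at_top"
proof -
  have "((\<lambda>X. (real (\<Sum>D\<in>discs e X. card (param_set D)) / X) / (real (card (discs e X)) / X))
      \<longlongrightarrow> (zeta 2 / zeta 3 / 2) / (1 / 2)) at_top"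
    by (intro tendsto_divide sum_param_set_asymp[OF e, unfolded suminf_totient_cubes] density_discs e) simp
  moreover have "\<forall>\<^sub>F X in at_top. (real (\<Sum>D\<in>discs e X. card (param_set D)) / X) / (real (card (discs e X)) / X)
      = (\<Sum>D\<in>discs e X. real (card (param_set D))) / real (card (discs e X))"
    using eventually_gt_at_top[of "0::real"] by eventually_elim simp
  ultimately have "((\<lambda>X. (\<Sum>D\<in>discs e X. real (card (param_set D))) / real (card (discs e X)))
      \<longlongrightarrow> (zeta 2 / zeta 3 / 2) / (1 / 2)) at_top"
    by (rule Lim_transform_eventually)
  then show ?thesis by simp
qed

section \<open>Lattices\<close>

text \<open>These rewrite rules loop together with \<open>of_int_mult\<close>, \<open>of_rat_mult\<close> and associativity.\<close>
declare int_mod.scale_scale [simp del] rat_vec.scale_scale [simp del]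

definition lat :: "complex \<Rightarrow> complex \<Rightarrow> complex set" where
  "lat a b = {z. \<exists>x y::int. z = of_int x * a + of_int y * b}"

lemma latI: "of_int x * a + of_int y * b \<in> lat a b"
  by (auto simp: lat_def)

lemma lat_gens [simp]: "a \<in> lat a b" "b \<in> lat a b"
  using latI[of 1 a 0 b] latI[of 0 a 1 b] by simp_all

text \<open>Integer multiples are iterated sums and differences, so submodules over the integers are
  the additive subgroups.\<close>

lemma subspace_int_iff:
  "int_mod.subspace S \<longleftrightarrow> 0 \<in> S \<and> (\<forall>x\<in>S. \<forall>y\<in>S. x - y \<in> S)"
proof
  assume "int_mod.subspace S"
  then show "0 \<in> S \<and> (\<forall>x\<in>S. \<forall>y\<in>S. x - y \<in> S)"
    by (simp add: int_mod.subspace_0 int_mod.subspace_diff)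
next
  assume S: "0 \<in> S \<and> (\<forall>x\<in>S. \<forall>y\<in>S. x - y \<in> S)"
  have neg: "- x \<in> S" if "x \<in> S" for x using S that by (metis diff_0)
  have add: "x + y \<in> S" if "x \<in> S" "y \<in> S" for x y using S neg that by (metis diff_minus_eq_add)
  have nat: "of_nat n * x \<in> S" if "x \<in> S" for n x
    by (induction n) (use S that in \<open>auto simp: algebra_simps intro: add\<close>)
  have "of_int k * x \<in> S" if "x \<in> S" for k x
    using nat[OF that] neg[OF nat[OF that]] by (cases k rule: int_cases2) auto
  then show "int_mod.subspace S"
    unfolding int_mod.subspace_def using S add by blast
qed

lemma subspace_lat: "int_mod.subspace (lat a b)"
  unfolding subspace_int_iff
proof (intro conjI ballI)
  show "0 \<in> lat a b" using latI[of 0 a 0 b] by simp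
  fix z w assume "z \<in> lat a b" "w \<in> lat a b"
  then obtain x y x' y' where "z = of_int x * a + of_int y * b" "w = of_int x' * a + of_int y' * b"
    by (auto simp: lat_def)
  then have "z - w = of_int (x - x') * a + of_int (y - y') * b" by (simp add: algebra_simps)
  then show "z - w \<in> lat a b" by (metis latI)
qed

lemma lat_subset:
  assumes "int_mod.subspace S" "a \<in> S" "b \<in> S"
  shows "lat a b \<subseteq> S"
  using assms by (auto simp: lat_def int_mod.subspace_add int_mod.subspace_scale)

lemma span_pair: "int_mod.span {a, b} = lat a b"
proof
  show "int_mod.span {a, b} \<subseteq> lat a b"
    by (rule int_mod.span_minimal) (simp_all add: subspace_lat)
  show "lat a b \<subseteq> int_mod.span {a, b}"
    by (rule lat_subset) (simp_all add: int_mod.span_base)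
qed

text \<open>For quadratic \<tau> this is the field generated by \<tau>, see
  \<open>is_subfield_qspan\<close>.\<close>

definition qspan :: "complex \<Rightarrow> complex set" where
  "qspan \<tau> = {z. \<exists>p q::rat. z = of_rat p + of_rat q * \<tau>}"

lemma qspanI: "of_rat p + of_rat q * \<tau> \<in> qspan \<tau>"
  by (auto simp: qspan_def)

lemma subspace_qspan: "rat_vec.subspace (qspan \<tau>)"
proof (rule rat_vec.subspaceI)
  show "0 \<in> qspan \<tau>" using qspanI[of 0 0] by simp
  fix x y c assume "x \<in> qspan \<tau>" "y \<in> qspan \<tau>"
  then obtain p q p' q' where xy: "x = of_rat p + of_rat q * \<tau>" "y = of_rat p' + of_rat q' * \<tau>"
    by (auto simp: qspan_def)
  have "x + y = of_rat (p + p') + of_rat (q + q') * \<tau>" using xy by (simp add: of_rat_add algebra_simps)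
  then show "x + y \<in> qspan \<tau>" by (metis qspanI)
next
  fix x c assume "x \<in> qspan \<tau>"
  then obtain p q where x: "x = of_rat p + of_rat q * \<tau>" by (auto simp: qspan_def)
  have "of_rat c * x = of_rat (c * p) + of_rat (c * q) * \<tau>" using x by (simp add: of_rat_mult algebra_simps)
  then show "of_rat c * x \<in> qspan \<tau>" by (metis qspanI)
qed

lemma rat_span_pair: "rat_vec.span {1, \<tau>} = qspan \<tau>"
proof
  have "1 \<in> qspan \<tau>" "\<tau> \<in> qspan \<tau>" using qspanI[of 1 0 \<tau>] qspanI[of 0 1 \<tau>] by simp_all
  then show "rat_vec.span {1, \<tau>} \<subseteq> qspan \<tau>"
    by (intro rat_vec.span_minimal) (simp_all add: subspace_qspan)
  show "qspan \<tau> \<subseteq> rat_vec.span {1, \<tau>}"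
  proof
    fix z assume "z \<in> qspan \<tau>"
    then obtain p q where "z = of_rat p * 1 + of_rat q * \<tau>" by (auto simp: qspan_def)
    then show "z \<in> rat_vec.span {1, \<tau>}"
      by (metis insertCI rat_vec.span_add rat_vec.span_base rat_vec.span_scale)
  qed
qed

lemma rat_coord_zero:
  assumes "\<tau> \<notin> \<rat>" "of_rat p + of_rat q * \<tau> = 0"
  shows "p = 0 \<and> q = 0"
proof -
  have "q = 0"
  proof (rule ccontr)
    assume "q \<noteq> 0"
    then have "\<tau> = of_rat (- p / q)"
      using assms(2) by (simp add: of_rat_divide of_rat_minus field_simps add_eq_0_iff)
    then show False using assms(1) by simp
  qed
  then show ?thesis using assms(2) by simp
qed

lemma rat_coord_eq:
  assumes "\<tau> \<notin> \<rat>" "of_rat p + of_rat q * \<tau> = of_rat p' + of_rat q' * \<tau>"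
  shows "p = p'" "q = q'"
proof -
  have "of_rat (p - p') + of_rat (q - q') * \<tau> = 0"
    using assms(2) by (simp add: of_rat_diff algebra_simps)
  from rat_coord_zero[OF assms(1) this] show "p = p'" "q = q'" by auto
qed

lemma int_coord_eq:
  assumes "\<tau> \<notin> \<rat>" "of_int x + of_int y * \<tau> = of_int x' + of_int y' * \<tau>"
  shows "x = x'" "y = y'"
  using rat_coord_eq[OF assms(1), of "of_int x" "of_int y" "of_int x'" "of_int y'"] assms(2) by simp_all

lemma rat_independent:
  assumes "\<tau> \<notin> \<rat>"
  shows "rat_vec.independent {1, \<tau>}" "card {1, \<tau>} = 2"
proof -
  have ne: "\<tau> \<noteq> 1" using assms by auto
  then show "card {1, \<tau>} = 2" by simp
  show "rat_vec.independent {1, \<tau>}"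
  proof
    assume "rat_vec.dependent {1, \<tau>}"
    then obtain u where u: "u 1 \<noteq> 0 \<or> u \<tau> \<noteq> 0" "(\<Sum>v\<in>{1, \<tau>}. of_rat (u v) * v) = 0"
      by (auto simp: rat_vec.dependent_finite)
    then have "of_rat (u 1) + of_rat (u \<tau>) * \<tau> = 0" using ne by simp
    then show False using rat_coord_zero[OF assms] u(1) by blast
  qed
qed

lemma int_independent:
  assumes "\<tau> \<notin> \<rat>"
  shows "\<not> int_mod.dependent {1, \<tau>}"
proof
  have ne: "\<tau> \<noteq> 1" using assms by auto
  assume "int_mod.dependent {1, \<tau>}"
  then obtain u :: "complex \<Rightarrow> int" where u: "u 1 \<noteq> 0 \<or> u \<tau> \<noteq> 0" "(\<Sum>v\<in>{1, \<tau>}. of_int (u v) * v) = 0"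
    by (auto simp: int_mod.dependent_finite)
  then have "of_int (u 1) + of_int (u \<tau>) * \<tau> = of_int 0 + of_int 0 * \<tau>" using ne by simp
  then show False using int_coord_eq[OF assms] u(1) by blast
qed

text \<open>Division with remainder by the least positive element shows that this element
  generates.\<close>

lemma int_subgroup_cyclic:
  fixes S :: "int set"
  assumes "\<And>x y. x \<in> S \<Longrightarrow> y \<in> S \<Longrightarrow> x - y \<in> S" "a \<in> S" "a \<noteq> 0"
  obtains g where "g > 0" "S = range (\<lambda>k. k * g)"
proof -
  have z: "0 \<in> S" using assms(1)[OF assms(2,2)] by simp
  have neg: "- x \<in> S" if "x \<in> S" for x using assms(1)[OF z that] by simp
  have add: "x + y \<in> S" if "x \<in> S" "y \<in> S" for x y using assms(1)[OF that(1) neg[OF that(2)]] by simp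
  have mult: "k * x \<in> S" if "x \<in> S" for k x
  proof (induction k rule: int_induct[of _ 0])
    case (step1 i)
    then show ?case using add[OF _ that] by (simp add: distrib_right)
  next
    case (step2 i)
    then show ?case using assms(1)[OF _ that] by (simp add: left_diff_distrib)
  qed (use z in simp)
  let ?P = "\<lambda>n. 0 < n \<and> int n \<in> S"
  have "?P (nat \<bar>a\<bar>)" using assms neg by (auto simp: abs_if)
  then have g: "?P (LEAST n. ?P n)" by (rule LeastI)
  have least: "(LEAST n. ?P n) \<le> n" if "?P n" for n using that by (rule Least_le)
  define g where "g = int (LEAST n. ?P n)"
  have gS: "g \<in> S" and gpos: "g > 0" using g by (simp_all add: g_def)
  have "S = range (\<lambda>k. k * g)"
  proof (intro equalityI subsetI)
    fix x assume x: "x \<in> S"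
    have "x mod g = x - (x div g) * g" by (simp add: minus_div_mult_eq_mod)
    then have r: "x mod g \<in> S" using assms(1)[OF x mult[OF gS]] by simp
    have "x mod g = 0"
    proof (rule ccontr)
      assume "x mod g \<noteq> 0"
      then have "0 < x mod g" using gpos by (simp add: order_less_le)
      then have "?P (nat (x mod g))" using r by simp
      from least[OF this] have "g \<le> x mod g" using \<open>0 < x mod g\<close> by (simp add: g_def)
      then show False using pos_mod_bound[OF gpos, of x] by simp
    qed
    then have "x = (x div g) * g" using div_mult_mod_eq[of x g] by simp
    then show "x \<in> range (\<lambda>k. k * g)" by blast
  qed (use mult gS in auto)
  then show ?thesis using that gpos by blast
qed

text \<open>A Hermite normal form: the rational part is generated by \<open>a\<close>, and \<open>b\<close> has the least
  positive \<open>\<theta>\<close>-coordinate.\<close>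
lemma lattice_basis:
  assumes G: "int_mod.subspace G" and N: "N > (0::int)" and irr: "\<theta> \<notin> \<rat>"
    and bd: "\<And>z. z \<in> G \<Longrightarrow> of_int N * z \<in> lat 1 \<theta>"
    and rat: "z0 \<in> G" "z0 \<in> \<rat>" "z0 \<noteq> 0" and nrat: "z1 \<in> G" "z1 \<notin> \<rat>"
  obtains a u v where "(a::rat) > 0" "v > (0::rat)" "G = lat (of_rat a) (of_rat u + of_rat v * \<theta>)"
proof -
  have N0: "of_int N \<noteq> (0::complex)" using N by simp
  \<comment> \<open>\<open>A\<close> holds the numerators over \<open>N\<close> of the rational
    elements of \<open>G\<close>, and \<open>V\<close> those of the \<theta>-coordinates of all
    elements. Both are subgroups of the integers, nonzero by \<open>z0\<close> and
    \<open>z1\<close>; their generators come from the two basis elements.\<close>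
  define A where "A = {x::int. \<exists>z\<in>G. of_int N * z = of_int x}"
  define V where "V = {y::int. \<exists>x. \<exists>z\<in>G. of_int N * z = of_int x + of_int y * \<theta>}"
  have diff: "z - w \<in> G" if "z \<in> G" "w \<in> G" for z w
    using G that by (rule int_mod.subspace_diff)
  have coords: "\<exists>x y. of_int N * z = of_int x + of_int y * \<theta>" if "z \<in> G" for z
    using bd[OF that] by (auto simp: lat_def)
  obtain x0 where x0: "x0 \<in> A" "x0 \<noteq> 0"
  proof -
    obtain q where q: "z0 = of_rat q" using rat(2) by (auto elim: Rats_cases)
    obtain x y where xy: "of_int N * z0 = of_int x + of_int y * \<theta>" using coords rat(1) by blast
    then have "of_rat (of_int N * q) + of_rat 0 * \<theta> = of_rat (of_int x) + of_rat (of_int y) * \<theta>"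
      by (simp add: q of_rat_mult)
    from rat_coord_eq(2)[OF irr this] have "y = 0" by simp
    then have "of_int N * z0 = of_int x" using xy by simp
    moreover from this have "x \<noteq> 0" using N0 rat(3) by auto
    ultimately show ?thesis using that rat(1) by (auto simp: A_def)
  qed
  have Ad: "x - y \<in> A" if xy: "x \<in> A" "y \<in> A" for x y
  proof -
    obtain z w where "z \<in> G" "w \<in> G" "of_int N * z = of_int x" "of_int N * w = of_int y"
      using xy by (auto simp: A_def)
    then have "of_int N * (z - w) = of_int (x - y)" "z - w \<in> G" using diff by (simp_all add: right_diff_distrib)
    then show ?thesis unfolding A_def by blast
  qed
  obtain g where g: "g > 0" "A = range (\<lambda>k. k * g)" using int_subgroup_cyclic[OF Ad x0] by blast
  obtain y1 where y1: "y1 \<in> V" "y1 \<noteq> 0"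
  proof -
    obtain x y where xy: "of_int N * z1 = of_int x + of_int y * \<theta>" using coords nrat(1) by blast
    have "y \<noteq> 0"
    proof
      assume "y = 0"
      then have "z1 = of_int x / of_int N" using xy N0 by (simp add: field_simps)
      then show False using nrat(2) by simp
    qed
    then show ?thesis using that xy nrat(1) by (auto simp: V_def)
  qed
  have Vd: "y - y' \<in> V" if yy: "y \<in> V" "y' \<in> V" for y y'
  proof -
    obtain x x' z w where "z \<in> G" "w \<in> G" "of_int N * z = of_int x + of_int y * \<theta>"
      "of_int N * w = of_int x' + of_int y' * \<theta>"
      using yy by (auto simp: V_def)
    then have "of_int N * (z - w) = of_int (x - x') + of_int (y - y') * \<theta>" "z - w \<in> G"
      using diff by (simp_all add: algebra_simps)
    then show ?thesis unfolding V_def by blast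
  qed
  obtain h where h: "h > 0" "V = range (\<lambda>k. k * h)" using int_subgroup_cyclic[OF Vd y1] by blast
  have "g \<in> A" unfolding g(2) by (rule range_eqI[of _ _ 1]) simp
  then obtain \<alpha> where \<alpha>: "\<alpha> \<in> G" "of_int N * \<alpha> = of_int g" by (auto simp: A_def)
  have "h \<in> V" unfolding h(2) by (rule range_eqI[of _ _ 1]) simp
  then obtain \<beta> r where \<beta>: "\<beta> \<in> G" "of_int N * \<beta> = of_int r + of_int h * \<theta>" by (auto simp: V_def)
  have "G = lat \<alpha> \<beta>"
  proof
    show "lat \<alpha> \<beta> \<subseteq> G" using lat_subset G \<alpha>(1) \<beta>(1) by blast
    show "G \<subseteq> lat \<alpha> \<beta>"
    proof
      fix z assume z: "z \<in> G"
      obtain x y where xy: "of_int N * z = of_int x + of_int y * \<theta>" using coords z by blast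
      then have "y \<in> V" using z by (auto simp: V_def)
      then obtain k where k: "y = k * h" unfolding h(2) by blast
      \<comment> \<open>Subtracting this multiple of \<beta> removes the \<theta>-coordinate of
        \<open>z\<close> and leaves a rational element of \<open>G\<close>.\<close>
      have "of_int k * \<beta> \<in> G" using G \<beta>(1) by (rule int_mod.subspace_scale)
      then have w: "z - of_int k * \<beta> \<in> G" using diff z by blast
      have "of_int N * (z - of_int k * \<beta>) = of_int N * z - of_int k * (of_int N * \<beta>)"
        by (simp add: algebra_simps)
      also have "\<dots> = of_int (x - k * r)" unfolding xy \<beta>(2) k by (simp add: algebra_simps)
      finally have "of_int N * (z - of_int k * \<beta>) = of_int (x - k * r)" .
      then have "x - k * r \<in> A" using w by (auto simp: A_def)
      then obtain l where "x - k * r = l * g" unfolding g(2) by blast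
      then have "of_int N * (z - of_int k * \<beta>) = of_int N * (of_int l * \<alpha>)"
        using \<open>of_int N * (z - of_int k * \<beta>) = of_int (x - k * r)\<close> \<alpha>(2)
        by (simp add: mult.left_commute)
      then have "z - of_int k * \<beta> = of_int l * \<alpha>" using N0 by (simp only: mult_cancel_left) simp
      then have "z = of_int l * \<alpha> + of_int k * \<beta>" by (simp add: algebra_simps)
      then show "z \<in> lat \<alpha> \<beta>" by (simp add: latI)
    qed
  qed
  moreover have "\<alpha> = of_rat (of_int g / of_int N)" using \<alpha>(2) N0 by (simp add: of_rat_divide field_simps)
  moreover have "\<beta> = of_rat (of_int r / of_int N) + of_rat (of_int h / of_int N) * \<theta>"
    using \<beta>(2) N0 by (simp add: of_rat_divide field_simps)
  ultimately show ?thesis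
    using that[of "of_int g / of_int N" "of_int h / of_int N" "of_int r / of_int N"] g(1) h(1) N by simp
qed

text \<open>\<open>t\<close> and \<open>n\<close> are the trace and the norm of \<tau>. An order is
  presented by a generator, and the locale is instantiated again for other generators, such as
  translates and integer multiples of a given one.\<close>

locale quadratic =
  fixes \<tau> :: complex and t n :: int
  assumes irr: "\<tau> \<notin> \<rat>" and sq: "\<tau> * \<tau> = of_int t * \<tau> - of_int n"

section \<open>Quadratic orders\<close>

lemma common_denominator:
  assumes "finite B" "\<And>b. b \<in> B \<Longrightarrow> \<exists>N>0. of_int N * b \<in> lat 1 \<theta>"
  shows "\<exists>N>(0::int). \<forall>b\<in>B. of_int N * b \<in> lat 1 \<theta>"
  using assms
proof (induction B rule: finite_induct)
  case empty
  then show ?case by (intro exI[of _ 1]) simp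
next
  case (insert b B)
  then obtain N M where N: "N > 0" "\<forall>b\<in>B. of_int N * b \<in> lat 1 \<theta>" and M: "M > 0" "of_int M * b \<in> lat 1 \<theta>"
    by (metis insertCI)
  have "of_int (N * M) * c \<in> lat 1 \<theta>" if "c \<in> insert b B" for c
  proof (cases "c = b")
    case True
    have "of_int N * (of_int M * b) \<in> lat 1 \<theta>"
      by (rule int_mod.subspace_scale[OF subspace_lat M(2)])
    then show ?thesis using True by (simp add: mult.assoc)
  next
    case False
    then have "of_int M * (of_int N * c) \<in> lat 1 \<theta>"
      using N(2) that by (intro int_mod.subspace_scale[OF subspace_lat, of "of_int N * c"]) auto
    then show ?thesis by (simp add: mult_ac)
  qed
  then show ?case using N(1) M(1) by (intro exI[of _ "N * M"]) auto
qed

lemma qspan_denominator: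
  assumes "z \<in> qspan \<theta>"
  shows "\<exists>N>(0::int). of_int N * z \<in> lat 1 \<theta>"
proof -
  obtain p q where z: "z = of_rat p + of_rat q * \<theta>" using assms by (auto simp: qspan_def)
  have frac: "\<exists>a b. r = of_int a / of_int b \<and> b > 0" for r :: rat
    by (cases r) (auto simp: Fract_of_int_quotient)
  obtain a b where p: "p = of_int a / of_int b" "b > 0" using frac by blast
  obtain c d where q: "q = of_int c / of_int d" "d > 0" using frac by blast
  have "of_int (b * d) * z = of_int (a * d) * 1 + of_int (c * b) * \<theta>"
    using p(2) q(2) by (simp add: z p(1) q(1) of_rat_divide field_simps)
  then have "of_int (b * d) * z \<in> lat 1 \<theta>" by (metis latI)
  then show ?thesis using p(2) q(2) by (intro exI[of _ "b * d"]) simp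
qed

text \<open>The elements that \<open>N\<close> carries into the lattice form a submodule, so a
  common denominator of the generators serves the whole span.\<close>

lemma finite_span_denominator:
  assumes "finite B" "int_mod.span B \<subseteq> qspan \<theta>"
  shows "\<exists>N>(0::int). \<forall>z\<in>int_mod.span B. of_int N * z \<in> lat 1 \<theta>"
proof -
  have "\<exists>N>0. of_int N * b \<in> lat 1 \<theta>" if "b \<in> B" for b
    using that assms(2) int_mod.span_base[of b B] qspan_denominator by blast
  then obtain N :: int where N: "N > 0" "\<forall>b\<in>B. of_int N * b \<in> lat 1 \<theta>"
    using common_denominator[OF assms(1), of \<theta>] by auto
  have "int_mod.subspace {z. of_int N * z \<in> lat 1 \<theta>}"
    using subspace_lat[of 1 \<theta>] by (auto simp: subspace_int_iff right_diff_distrib)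
  then have "int_mod.span B \<subseteq> {z. of_int N * z \<in> lat 1 \<theta>}"
    using N(2) by (intro int_mod.span_minimal) auto
  then show ?thesis using N(1) by blast
qed

text \<open>In the basis from \<open>lattice_basis\<close> the rational elements of \<open>R\<close>
  are the multiples of \<open>a\<close>. Among them are 1 and \<open>a * a\<close>, so both 1 / a
  and a are integers and a = 1. The square of the second basis element lies in \<open>R\<close>,
  which gives its quadratic equation.\<close>

lemma quadratic_order_imp_quadratic:
  assumes "quadratic_order R"
  obtains \<tau> t n where "quadratic \<tau> t n" "R = lat 1 \<tau>"
proof -
  obtain K B where K: "is_subfield K" "rat_vec.dim K = 2" and R: "is_subring R"
    and B: "finite B" "int_mod.span B = R" and span: "rat_vec.span R = K"
    using assms by (auto simp: quadratic_order_def quadratic_field_def order_in_def)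
  have one: "1 \<in> R" using R by (simp add: is_subring_def)
  \<comment> \<open>A ring of rational numbers would span a space of dimension 1 only.\<close>
  obtain \<theta> where \<theta>: "\<theta> \<in> R" "\<theta> \<notin> \<rat>"
  proof (rule ccontr)
    assume "\<not> thesis"
    then have "R \<subseteq> \<rat>" using that by blast
    moreover have "\<rat> = rat_vec.span {1::complex}"
      by (auto simp: rat_vec.span_singleton Rats_def)
    ultimately have "rat_vec.span R \<subseteq> rat_vec.span {1}"
      by (intro rat_vec.span_minimal rat_vec.subspace_span) blast
    then have "K \<subseteq> rat_vec.span {1}" by (simp only: span)
    moreover have "rat_vec.span {1} \<subseteq> K" using rat_vec.span_mono[of "{1}" R] one span by simp
    ultimately have "K = rat_vec.span {1}" by (rule equalityI)
    then have "rat_vec.dim K = rat_vec.dim {1}" by (simp only: rat_vec.dim_span)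
    also have "\<dots> = card {1::complex}" by (rule rat_vec.dim_eq_card_independent) simp
    finally show False using K(2) by simp
  qed
  have RK: "R \<subseteq> K" using span rat_vec.span_superset by blast
  have "{1, \<theta>} \<subseteq> K" using RK one \<theta>(1) by blast
  then obtain C where C: "{1, \<theta>} \<subseteq> C" "C \<subseteq> K" "rat_vec.independent C" "K \<subseteq> rat_vec.span C"
    using rat_vec.maximal_independent_subset_extend[of "{1, \<theta>}" K] rat_independent(1)[OF \<theta>(2)] by blast
  have "card C = 2" using rat_vec.basis_card_eq_dim[OF C(2,4,3)] K(2) by simp
  then have "C = {1, \<theta>}" using C(1) rat_independent(2)[OF \<theta>(2)]
    by (metis card_ge_0_finite card_subset_eq zero_less_numeral)
  then have "R \<subseteq> qspan \<theta>" using RK C(4) rat_span_pair by blast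
  then obtain N :: int where N: "N > 0" "\<And>z. z \<in> R \<Longrightarrow> of_int N * z \<in> lat 1 \<theta>"
    using finite_span_denominator[OF B(1)] B(2) by blast
  have sub: "int_mod.subspace R" using B(2) int_mod.subspace_span by blast
  obtain a u v where auv: "(a::rat) > 0" "v > 0" "R = lat (of_rat a) (of_rat u + of_rat v * \<theta>)"
    using lattice_basis[OF sub N(1) \<theta>(2) N(2) one Rats_1 one_neq_zero \<theta>] by blast
  define \<tau> where "\<tau> = of_rat u + of_rat v * \<theta>"
  have irr: "\<tau> \<notin> \<rat>"
  proof
    assume "\<tau> \<in> \<rat>"
    then obtain q where "\<tau> = of_rat q" by (auto elim: Rats_cases)
    then have "of_rat u + of_rat v * \<theta> = of_rat q + of_rat 0 * \<theta>" by (simp add: \<tau>_def)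
    from rat_coord_eq(2)[OF \<theta>(2) this] show False using auv(2) by simp
  qed
  have ratmem: "\<exists>k::int. q = of_int k * a" if q: "of_rat q \<in> R" for q
  proof -
    obtain x y where "of_rat q = of_int x * of_rat a + of_int y * \<tau>"
      using q auv(3) by (auto simp: lat_def \<tau>_def)
    then have "of_rat q + of_rat 0 * \<tau> = of_rat (of_int x * a) + of_rat (of_int y) * \<tau>"
      by (simp add: of_rat_mult)
    from rat_coord_eq(1)[OF irr this] show ?thesis by blast
  qed
  have "of_rat 1 \<in> R" using one by simp
  then obtain j :: int where j: "1 = of_int j * a" using ratmem by blast
  have "of_rat a \<in> R" using auv(3) by simp
  then have "of_rat (a * a) \<in> R" using R by (simp add: is_subring_def of_rat_mult)
  then obtain k :: int where "a * a = of_int k * a" using ratmem by blast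
  then have ak: "a = of_int k" using auv(1) by simp
  then have "1 = j * k" using j by (metis of_int_eq_1_iff of_int_mult)
  then have "a = 1" using ak auv(1) by (metis abs_of_pos abs_zmult_eq_1 mult.commute of_int_1 of_int_0_less_iff abs_1)
  then have R1: "R = lat 1 \<tau>" using auv(3) by (simp add: \<tau>_def)
  have "\<tau> \<in> R" by (simp add: R1)
  then have "\<tau> * \<tau> \<in> lat 1 \<tau>" using R R1 by (simp add: is_subring_def)
  then obtain x y where "\<tau> * \<tau> = of_int x * 1 + of_int y * \<tau>" by (auto simp: lat_def)
  then have "quadratic \<tau> y (- x)" using irr by unfold_locales simp_all
  then show ?thesis using that R1 by blast
qed

section \<open>Field arithmetic, trace and discriminant in coordinates\<close>

context quadratic
begin

definition norm_form :: "rat \<Rightarrow> rat \<Rightarrow> rat" where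
  "norm_form p q = p * p + of_int t * p * q + of_int n * q * q"

lemma mult_coords:
  "(of_rat p + of_rat q * \<tau>) * (of_rat p' + of_rat q' * \<tau>) =
     of_rat (p * p' - of_int n * (q * q')) + of_rat (p * q' + q * p' + of_int t * (q * q')) * \<tau>"
proof -
  have "(of_rat p + of_rat q * \<tau>) * (of_rat p' + of_rat q' * \<tau>) =
    of_rat (p * p') + of_rat (p * q' + q * p') * \<tau> + of_rat (q * q') * (\<tau> * \<tau>)"
    by (simp add: of_rat_mult of_rat_add algebra_simps)
  then show ?thesis unfolding sq by (simp add: of_rat_mult of_rat_add of_rat_diff algebra_simps)
qed

text \<open>The second factor is the conjugate, obtained by replacing \<tau> with t -
  \<tau>.\<close>

lemma norm_coords:
  "(of_rat p + of_rat q * \<tau>) * (of_rat (p + of_int t * q) + of_rat (- q) * \<tau>) = of_rat (norm_form p q)"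
  unfolding mult_coords by (simp add: norm_form_def algebra_simps)

lemma norm_form_nonzero:
  assumes "p \<noteq> 0 \<or> q \<noteq> 0"
  shows "norm_form p q \<noteq> 0"
proof
  assume "norm_form p q = 0"
  then have "of_rat p + of_rat q * \<tau> = 0 \<or> of_rat (p + of_int t * q) + of_rat (- q) * \<tau> = 0"
    using norm_coords[of p q] by simp
  then show False using rat_coord_zero[OF irr] assms by fastforce
qed

lemma is_subring_lat: "is_subring (lat 1 \<tau>)"
  unfolding is_subring_def
proof (intro conjI ballI)
  fix z w assume "z \<in> lat 1 \<tau>" "w \<in> lat 1 \<tau>"
  then obtain x y x' y' where zw: "z = of_int x + of_int y * \<tau>" "w = of_int x' + of_int y' * \<tau>"
    by (auto simp: lat_def)
  have "z - w = of_int (x - x') * 1 + of_int (y - y') * \<tau>" by (simp add: zw algebra_simps)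
  then show "z - w \<in> lat 1 \<tau>" by (metis latI)
  have "z * w = of_int (x * x') + of_int (x * y' + y * x') * \<tau> + of_int (y * y') * (\<tau> * \<tau>)"
    by (simp add: zw algebra_simps)
  also have "\<dots> = of_int (x * x' - n * (y * y')) * 1 + of_int (x * y' + y * x' + t * (y * y')) * \<tau>"
    unfolding sq by (simp add: algebra_simps)
  finally show "z * w \<in> lat 1 \<tau>" by (simp only: latI)
qed simp

lemma lat_subset_qspan: "lat 1 \<tau> \<subseteq> qspan \<tau>"
proof
  fix z assume "z \<in> lat 1 \<tau>"
  then obtain x y where "z = of_rat (of_int x) + of_rat (of_int y) * \<tau>" by (auto simp: lat_def)
  then show "z \<in> qspan \<tau>" by (metis qspanI)
qed

lemma inverse_qspan:
  assumes "z \<in> qspan \<tau>"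
  shows "inverse z \<in> qspan \<tau>"
proof (cases "z = 0")
  case False
  obtain p q where z: "z = of_rat p + of_rat q * \<tau>" using assms by (auto simp: qspan_def)
  then have "p \<noteq> 0 \<or> q \<noteq> 0" using False by auto
  then have N: "of_rat (norm_form p q) \<noteq> (0::complex)" using norm_form_nonzero by simp
  have "inverse z = (of_rat (p + of_int t * q) + of_rat (- q) * \<tau>) / of_rat (norm_form p q)"
    using norm_coords[of p q] z False N by (simp add: field_simps)
  also have "\<dots> = of_rat ((p + of_int t * q) / norm_form p q) + of_rat (- q / norm_form p q) * \<tau>"
    by (simp add: of_rat_divide of_rat_add add_divide_distrib diff_divide_distrib)
  finally show ?thesis by (metis qspanI)
qed (use assms in simp)

lemma is_subfield_qspan: "is_subfield (qspan \<tau>)"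
  unfolding is_subfield_def is_subring_def
proof (intro conjI ballI)
  show "1 \<in> qspan \<tau>" using qspanI[of 1 0 \<tau>] by simp
  fix z w assume zw: "z \<in> qspan \<tau>" "w \<in> qspan \<tau>"
  then show "z - w \<in> qspan \<tau>" using rat_vec.subspace_diff[OF subspace_qspan] by blast
  show "z * w \<in> qspan \<tau>" using zw by (auto simp: qspan_def mult_coords) metis
qed (use inverse_qspan in blast)

lemma dim_qspan: "rat_vec.dim (qspan \<tau>) = 2"
  using rat_independent[OF irr] rat_vec.dim_eq_card_independent[of "{1, \<tau>}"]
    rat_vec.dim_span[of "{1, \<tau>}"] unfolding rat_span_pair by simp

lemma quadratic_order_lat: "quadratic_order (lat 1 \<tau>)"
  unfolding quadratic_order_def quadratic_field_def order_in_def
proof (rule exI[of _ "qspan \<tau>"], intro conjI)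
  show "rat_vec.dim (qspan \<tau>) = 2" by (rule dim_qspan)
  show "\<exists>B. finite B \<and> int_mod.span B = lat 1 \<tau>"
    by (rule exI[of _ "{1, \<tau>}"]) (simp add: span_pair)
  show "rat_vec.span (lat 1 \<tau>) = qspan \<tau>"
  proof
    show "rat_vec.span (lat 1 \<tau>) \<subseteq> qspan \<tau>"
      by (rule rat_vec.span_minimal[OF lat_subset_qspan subspace_qspan])
    show "qspan \<tau> \<subseteq> rat_vec.span (lat 1 \<tau>)"
      unfolding rat_span_pair[symmetric] by (rule rat_vec.span_mono) simp
  qed
qed (simp_all add: is_subfield_qspan is_subring_lat)

lemma fraction_field_lat: "fraction_field (lat 1 \<tau>) = qspan \<tau>"
proof
  have "x / y \<in> qspan \<tau>" if "x \<in> qspan \<tau>" "y \<in> qspan \<tau>" for x y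
    using that is_subfield_qspan by (simp add: divide_inverse is_subfield_def is_subring_def)
  then show "fraction_field (lat 1 \<tau>) \<subseteq> qspan \<tau>"
    using lat_subset_qspan by (auto simp: fraction_field_def)
  show "qspan \<tau> \<subseteq> fraction_field (lat 1 \<tau>)"
  proof
    fix z assume "z \<in> qspan \<tau>"
    then obtain N :: int where N: "N > 0" "of_int N * z \<in> lat 1 \<tau>" using qspan_denominator by blast
    moreover have "of_int N \<in> lat 1 \<tau>" using latI[of N 1 0 \<tau>] by simp
    moreover have "z = of_int N * z / of_int N" using N(1) by simp
    ultimately show "z \<in> fraction_field (lat 1 \<tau>)"
      unfolding fraction_field_def using N(1) by fastforce
  qed
qed

text \<open>In any basis, multiplication by an irrational \<open>x\<close> has a rational characteristic polynomial
  that vanishes at \<open>x\<close>; as \<open>x\<close> is a root of only one monic rational quadratic, the trace can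
  be read off.\<close>
lemma field_trace_qspan: "field_trace (qspan \<tau>) (of_rat p + of_rat q * \<tau>) = 2 * p + of_int t * q"
proof -
  define x where "x = of_rat p + of_rat q * \<tau>"
  have xx: "x * x = of_rat (2 * p + of_int t * q) * x - of_rat (norm_form p q)"
  proof -
    have "x * x = of_rat (2 * p + of_int t * q) * x - x * (of_rat (p + of_int t * q) + of_rat (- q) * \<tau>)"
      by (simp add: x_def of_rat_add of_rat_mult of_rat_minus algebra_simps)
    then show ?thesis using norm_coords[of p q] by (simp add: x_def)
  qed
  define B where "B = (SOME B. rat_vec.independent B \<and> rat_vec.span B = qspan \<tau>)"
  have "rat_vec.independent B \<and> rat_vec.span B = qspan \<tau>"
    unfolding B_def using rat_independent(1)[OF irr] rat_span_pair by (intro someI) blast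
  then have B: "rat_vec.independent B" "rat_vec.span B = qspan \<tau>" by auto
  have "card B = 2"
    using rat_vec.dim_eq_card_independent[OF B(1)] rat_vec.dim_span[of B] dim_qspan unfolding B(2) by simp
  then obtain b c where bc: "B = {b, c}" "b \<noteq> c" by (auto simp: card_2_iff)
  have mem: "x * b \<in> rat_vec.span B" "x * c \<in> rat_vec.span B"
  proof -
    have "b \<in> qspan \<tau>" "c \<in> qspan \<tau>" "x \<in> qspan \<tau>"
      using B(2) bc(1) rat_vec.span_base[of _ B] by (auto simp: x_def qspanI)
    then show "x * b \<in> rat_vec.span B" "x * c \<in> rat_vec.span B"
      using is_subfield_qspan B(2) by (simp_all add: is_subfield_def is_subring_def)
  qed
  let ?r = "\<lambda>z. rat_vec.representation B z"
  have repr: "of_rat (?r z b) * b + of_rat (?r z c) * c = z" if "z \<in> rat_vec.span B" for z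
    using rat_vec.sum_representation_eq[OF B(1) that, of B] bc by simp
  define e f g h where "e = ?r (x * b) b" and "f = ?r (x * b) c" and "g = ?r (x * c) b" and "h = ?r (x * c) c"
  have e1: "(of_rat e - x) * b + of_rat f * c = 0" "of_rat g * b + (of_rat h - x) * c = 0"
    using repr[OF mem(1)] repr[OF mem(2)] by (simp_all add: e_def f_def g_def h_def algebra_simps)
  have tr: "field_trace (qspan \<tau>) x = e + h"
    unfolding field_trace_def Let_def B_def[symmetric] using bc by (simp add: e_def h_def)
  have "b \<noteq> 0" "c \<noteq> 0" using B(1) bc rat_vec.dependent_zero by auto
  \<comment> \<open>Elimination of \<open>c\<close> from \<open>e1\<close>: the characteristic
    polynomial of the matrix of multiplication by \<open>x\<close>, evaluated at \<open>x\<close>,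
    annihilates \<open>b\<close>.\<close>
  have "((of_rat e - x) * (of_rat h - x) - of_rat f * of_rat g) * b =
      (of_rat h - x) * ((of_rat e - x) * b + of_rat f * c) - of_rat f * (of_rat g * b + (of_rat h - x) * c)"
    by (simp add: algebra_simps)
  also have "\<dots> = 0" unfolding e1 by simp
  finally have "(of_rat e - x) * (of_rat h - x) - of_rat f * of_rat g = 0" using \<open>b \<noteq> 0\<close> by simp
  then have char: "x * x = of_rat (e + h) * x - of_rat (e * h - f * g)"
    by (simp add: of_rat_add of_rat_mult of_rat_diff algebra_simps)
  have "e + h = 2 * p + of_int t * q"
  proof (cases "q = 0")
    case False
    have "x \<notin> \<rat>"
    proof
      assume "x \<in> \<rat>"
      then obtain s where "x = of_rat s" by (auto elim: Rats_cases)
      then have "of_rat p + of_rat q * \<tau> = of_rat s + of_rat 0 * \<tau>" by (simp add: x_def)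
      from rat_coord_eq(2)[OF irr this] show False using False by simp
    qed
    have "of_rat (- norm_form p q) + of_rat (2 * p + of_int t * q) * x = x * x"
      by (simp only: xx of_rat_minus uminus_add_conv_diff)
    also have "\<dots> = of_rat (- (e * h - f * g)) + of_rat (e + h) * x"
      by (simp only: char of_rat_minus uminus_add_conv_diff)
    finally have "of_rat (- norm_form p q) + of_rat (2 * p + of_int t * q) * x
      = of_rat (- (e * h - f * g)) + of_rat (e + h) * x" .
    from rat_coord_eq(2)[OF \<open>x \<notin> \<rat>\<close> this] show ?thesis by simp
  next
    \<comment> \<open>A rational \<open>x\<close> is a root of many monic quadratics, so the
      comparison fails here; multiplication by \<open>x\<close> is scalar and the diagonal entries
      are read off directly.\<close>
    case True
    then have xp: "x = of_rat p" by (simp add: x_def)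
    have "e = p"
      unfolding e_def xp using B(1) bc rat_vec.span_base[of b B] rat_vec.representation_scale[OF B(1), of b p]
      by (simp add: rat_vec.representation_basis)
    moreover have "h = p"
      unfolding h_def xp using B(1) bc rat_vec.span_base[of c B] rat_vec.representation_scale[OF B(1), of c p]
      by (simp add: rat_vec.representation_basis)
    ultimately show ?thesis using True by simp
  qed
  then show ?thesis using tr by (simp add: x_def)
qed

text \<open>The matrices that express each basis in the other are inverse to each other, so their
  integral determinants have product 1.\<close>

lemma lat_basis_change:
  assumes "lat a b = lat 1 \<tau>"
  obtains x y z w where "a = of_int x + of_int y * \<tau>" "b = of_int z + of_int w * \<tau>" "\<bar>x * w - y * z\<bar> = 1"
proof -
  have "a \<in> lat 1 \<tau>" "b \<in> lat 1 \<tau>" unfolding assms[symmetric] by (rule lat_gens)+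
  then obtain x y z w where ab: "a = of_int x + of_int y * \<tau>" "b = of_int z + of_int w * \<tau>"
    unfolding lat_def by auto
  have "1 \<in> lat a b" "\<tau> \<in> lat a b" unfolding assms by (rule lat_gens)+
  then obtain p q r s where pq: "1 = of_int p * a + of_int q * b" and rs: "\<tau> = of_int r * a + of_int s * b"
    unfolding lat_def mem_Collect_eq by blast
  have "of_int (p * x + q * z) + of_int (p * y + q * w) * \<tau> = of_int p * a + of_int q * b"
    by (simp add: ab algebra_simps)
  also have "\<dots> = of_int 1 + of_int 0 * \<tau>" by (simp only: pq[symmetric] of_int_1 of_int_0 mult_zero_left add_0_right)
  finally have c1: "p * x + q * z = 1" "p * y + q * w = 0" using int_coord_eq[OF irr] by blast+
  have "of_int (r * x + s * z) + of_int (r * y + s * w) * \<tau> = of_int r * a + of_int s * b"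
    by (simp add: ab algebra_simps)
  also have "\<dots> = of_int 0 + of_int 1 * \<tau>" by (simp only: rs[symmetric] of_int_1 of_int_0 mult_1_left add_0_left)
  finally have c2: "r * x + s * z = 0" "r * y + s * w = 1" using int_coord_eq[OF irr] by blast+
  have "(p * s - q * r) * (x * w - y * z) = (p * x + q * z) * (r * y + s * w) - (p * y + q * w) * (r * x + s * z)"
    by (simp add: algebra_simps)
  then have "(p * s - q * r) * (x * w - y * z) = 1" unfolding c1 c2 by simp
  then have "\<bar>(x * w - y * z) * (p * s - q * r)\<bar> = 1" by (simp only: mult.commute abs_1)
  then have "\<bar>x * w - y * z\<bar> = 1" by (rule abs_zmult_eq_1)
  then show ?thesis using that ab by blast
qed

text \<open>A change of basis multiplies the determinant of the trace form by the square of its own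
  determinant, which is 1. So the basis 1, \<tau> decides the value.\<close>

lemma Disc_lat: "Disc (lat 1 \<tau>) = t * t - 4 * n"
  unfolding Disc_def
proof (rule the_equality)
  let ?Tr = "field_trace (fraction_field (lat 1 \<tau>))"
  have tr: "?Tr (of_int x + of_int y * \<tau>) = of_int (2 * x + t * y)" for x y
    using field_trace_qspan[of "of_int x" "of_int y"] by (simp add: fraction_field_lat)
  have mult: "(of_int x + of_int y * \<tau>) * (of_int z + of_int w * \<tau>) =
      of_int (x * z - n * (y * w)) + of_int (x * w + y * z + t * (y * w)) * \<tau>" for x y z w
    using mult_coords[of "of_int x" "of_int y" "of_int z" "of_int w"]
    by (simp flip: of_int_mult of_int_add of_int_diff)
  have det: "?Tr (a * a) * ?Tr (b * b) - ?Tr (a * b) * ?Tr (b * a) = of_int ((x * w - y * z)^2 * (t * t - 4 * n))"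
    if "a = of_int x + of_int y * \<tau>" "b = of_int z + of_int w * \<tau>" for a b x y z w
    unfolding that mult tr by (simp add: algebra_simps power2_eq_square)
  show "\<exists>a b. a \<noteq> b \<and> \<not> int_mod.dependent {a, b} \<and> int_mod.span {a, b} = lat 1 \<tau> \<and>
     (let Tr = ?Tr in of_int (t * t - 4 * n) = Tr (a * a) * Tr (b * b) - Tr (a * b) * Tr (b * a))"
  proof (intro exI conjI)
    show "1 \<noteq> \<tau>" using irr by auto
    show "\<not> int_mod.dependent {1, \<tau>}" by (rule int_independent[OF irr])
    show "int_mod.span {1, \<tau>} = lat 1 \<tau>" by (rule span_pair)
    show "let Tr = ?Tr in of_int (t * t - 4 * n) = Tr (1 * 1) * Tr (\<tau> * \<tau>) - Tr (1 * \<tau>) * Tr (\<tau> * 1)"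
      using det[of 1 1 0 \<tau> 0 1] by (simp add: Let_def)
  qed
  fix d assume "\<exists>a b. a \<noteq> b \<and> \<not> int_mod.dependent {a, b} \<and> int_mod.span {a, b} = lat 1 \<tau> \<and>
     (let Tr = ?Tr in of_int d = Tr (a * a) * Tr (b * b) - Tr (a * b) * Tr (b * a))"
  then obtain a b where ab: "lat a b = lat 1 \<tau>" "of_int d = ?Tr (a * a) * ?Tr (b * b) - ?Tr (a * b) * ?Tr (b * a)"
    by (auto simp: span_pair Let_def)
  obtain x y z w where c: "a = of_int x + of_int y * \<tau>" "b = of_int z + of_int w * \<tau>" "\<bar>x * w - y * z\<bar> = 1"
    using lat_basis_change[OF ab(1)] by blast
  have "(x * w - y * z)^2 = 1" using c(3) by (metis power2_abs one_power2)
  then have "(of_int d :: rat) = of_int (t * t - 4 * n)" using ab(2) det[OF c(1,2)] by simp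
  then show "d = t * t - 4 * n" by (simp only: of_int_eq_iff)
qed

end

section \<open>Isomorphism classes\<close>

definition is_disc :: "int \<Rightarrow> bool" where
  "is_disc D \<longleftrightarrow> (D mod 4 = 0 \<or> D mod 4 = 1) \<and> \<not> (\<exists>k. D = k\<^sup>2)"

text \<open>The generator has trace \<open>D\<close> and norm \<open>(D * D - D) div 4\<close>,
  which avoids a distinction between the residues 0 and 1 modulo 4. Which square root
  \<open>csqrt\<close> selects does not matter for the ring.\<close>

definition quad_ring :: "int \<Rightarrow> complex set" where
  "quad_ring D = lat 1 ((of_int D + csqrt (of_int D)) / 2)"

text \<open>If \<delta> = a / b, then b^2 divides a^2, so b divides a.\<close>

lemma rational_sqrt_int:
  assumes "\<delta> * \<delta> = (of_int D :: complex)" "\<delta> \<in> \<rat>"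
  shows "\<exists>k. D = k\<^sup>2"
proof -
  obtain r where r: "\<delta> = of_rat r" using assms(2) by (auto elim: Rats_cases)
  have "(of_rat (r * r) :: complex) = of_rat (of_int D)" using assms(1) r by (simp add: of_rat_mult)
  then have rr: "r * r = of_int D" by (simp only: of_rat_eq_iff)
  obtain a b where ab: "r = of_int a / of_int b" "b > 0"
    by (cases r) (auto simp: Fract_of_int_quotient)
  have "of_int (a * a) = (of_int (D * (b * b)) :: rat)" using rr ab by (simp add: field_simps)
  then have e: "a * a = D * (b * b)" by (simp only: of_int_eq_iff)
  then have "b ^ 2 dvd a ^ 2" by (simp add: power2_eq_square)
  then have "b dvd a" by simp
  then obtain k where "a = b * k" by auto
  then have "k * k * (b * b) = D * (b * b)" using e by (simp add: mult_ac)
  then have "D = k * k" using ab(2) by simp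
  then show ?thesis by (auto simp: power2_eq_square)
qed

lemma csqrt_mult_self: "csqrt z * csqrt z = z"
  by (simp flip: power2_eq_square)

lemma csqrt_irrational:
  assumes "is_disc D"
  shows "csqrt (of_int D) \<notin> \<rat>"
  using rational_sqrt_int[OF csqrt_mult_self] assms unfolding is_disc_def by blast

lemma lat_translate: "lat a (b + of_int k * a) = lat a b"
proof
  show "lat a (b + of_int k * a) \<subseteq> lat a b"
    using latI[of k a 1 b] by (intro lat_subset[OF subspace_lat]) (simp_all add: add.commute)
  have "b \<in> lat a (b + of_int k * a)"
    using latI[of "- k" a 1 "b + of_int k * a"] by simp
  then show "lat a b \<subseteq> lat a (b + of_int k * a)"
    by (intro lat_subset[OF subspace_lat]) simp_all
qed

lemma lat_uminus: "lat a (- b) = lat a b"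
proof
  show "lat a (- b) \<subseteq> lat a b"
    using latI[of 0 a "-1" b] by (intro lat_subset[OF subspace_lat]) simp_all
  show "lat a b \<subseteq> lat a (- b)"
    using latI[of 0 a "-1" "- b"] by (intro lat_subset[OF subspace_lat]) simp_all
qed

lemma four_dvd_disc:
  assumes "is_disc D"
  shows "4 dvd D * D - D"
proof -
  have "D = 4 * (D div 4) \<or> D = 4 * (D div 4) + 1" using assms div_mult_mod_eq[of D 4] unfolding is_disc_def by linarith
  then obtain k where "D = 4 * k \<or> D = 4 * k + 1" by blast
  then have "D * D - D = 4 * (4 * k * k - k) \<or> D * D - D = 4 * (4 * k * k + k)"
    by (auto simp: algebra_simps)
  then show ?thesis by (metis dvd_triv_left)
qed

lemma quadratic_quad_ring:
  assumes "is_disc D"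
  shows "quadratic ((of_int D + csqrt (of_int D)) / 2) D ((D * D - D) div 4)"
proof
  let ?\<delta> = "csqrt (of_int D)"
  show "(of_int D + ?\<delta>) / 2 \<notin> \<rat>"
  proof
    assume "(of_int D + ?\<delta>) / 2 \<in> \<rat>"
    then have "2 * ((of_int D + ?\<delta>) / 2) - of_int D \<in> \<rat>" by (intro Rats_diff Rats_mult) simp_all
    moreover have "2 * ((of_int D + ?\<delta>) / 2) - of_int D = ?\<delta>" by (simp add: field_simps)
    ultimately show False using csqrt_irrational[OF assms] by (simp only:)
  qed
  have "4 dvd D * D - D" using assms by (rule four_dvd_disc)
  then obtain n where n: "D * D - D = 4 * n" by auto
  then have n': "(D * D - D) div 4 = n" by simp
  have "of_int (4 * n) = (of_int (D * D - D) :: complex)" using n by simp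
  then have n2: "4 * of_int n = of_int D * of_int D - (of_int D :: complex)" by simp
  have "4 * ((of_int D + ?\<delta>) / 2 * ((of_int D + ?\<delta>) / 2)) = of_int D * of_int D + 2 * of_int D * ?\<delta> + ?\<delta> * ?\<delta>"
    by (simp add: field_simps)
  also have "\<dots> = 4 * (of_int D * ((of_int D + ?\<delta>) / 2)) - 4 * of_int n"
    unfolding csqrt_mult_self n2 by (simp add: field_simps)
  finally show "(of_int D + ?\<delta>) / 2 * ((of_int D + ?\<delta>) / 2)
      = of_int D * ((of_int D + ?\<delta>) / 2) - of_int ((D * D - D) div 4)"
    unfolding n' right_diff_distrib[symmetric] by (simp only: mult_cancel_left) simp
qed

lemma disc_quad_ring:
  assumes "is_disc D"
  shows "D * D - 4 * ((D * D - D) div 4) = D"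
  using four_dvd_disc[OF assms] by simp

lemma Disc_quad_ring:
  assumes "is_disc D"
  shows "Disc (quad_ring D) = D"
  using quadratic.Disc_lat[OF quadratic_quad_ring[OF assms]] disc_quad_ring[OF assms]
  by (simp only: quad_ring_def)

context quadratic
begin

text \<open>\<open>2 * \<tau> - of_int t\<close> is the difference of \<tau> and its
  conjugate.\<close>

lemma sqrt_disc: "(2 * \<tau> - of_int t) * (2 * \<tau> - of_int t) = of_int (t * t - 4 * n)"
proof -
  have "(2 * \<tau> - of_int t) * (2 * \<tau> - of_int t) = 4 * (\<tau> * \<tau>) - 4 * of_int t * \<tau> + of_int t * of_int t"
    by (simp add: algebra_simps)
  then show ?thesis unfolding sq by (simp add: algebra_simps)
qed

lemma sqrt_disc_cases:
  "2 * \<tau> - of_int t = csqrt (of_int (t * t - 4 * n)) \<or> 2 * \<tau> - of_int t = - csqrt (of_int (t * t - 4 * n))"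
  using sqrt_disc csqrt_mult_self[of "of_int (t * t - 4 * n)"] by (metis square_eq_iff)

lemma is_disc: "is_disc (t * t - 4 * n)"
  unfolding is_disc_def
proof
  show "(t * t - 4 * n) mod 4 = 0 \<or> (t * t - 4 * n) mod 4 = 1"
  proof (cases "even t")
    case True
    then obtain k where "t = 2 * k" by auto
    then have "t * t - 4 * n = 4 * (k * k - n)" by simp
    then show ?thesis by simp
  next
    case False
    then obtain k where "t = 2 * k + 1" by (auto elim: oddE)
    then have "t * t - 4 * n = 4 * (k * k + k - n) + 1" by (simp add: algebra_simps)
    then show ?thesis by presburger
  qed
  show "\<not> (\<exists>k. t * t - 4 * n = k\<^sup>2)"
  proof
    assume "\<exists>k. t * t - 4 * n = k\<^sup>2"
    then obtain k where k: "t * t - 4 * n = k\<^sup>2" by blast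
    have "(2 * \<tau> - of_int t) * (2 * \<tau> - of_int t) = of_int k * of_int k"
      unfolding sqrt_disc k by (simp add: power2_eq_square)
    then have "2 * \<tau> - of_int t = of_int k \<or> 2 * \<tau> - of_int t = - of_int k" by (simp only: square_eq_iff)
    then have "2 * \<tau> - of_int t \<in> \<rat>" by auto
    then have "(2 * \<tau> - of_int t + of_int t) / 2 \<in> \<rat>" by (intro Rats_divide Rats_add) simp_all
    then show False using irr by simp
  qed
qed

text \<open>As D and t have the same parity, the standard generator differs from \<tau> or from
  -\<tau> by an integer. So the order, as a set of complex numbers, is determined by its
  discriminant.\<close>

lemma lat_eq_quad_ring: "lat 1 \<tau> = quad_ring (t * t - 4 * n)"
proof -
  define D where "D = t * t - 4 * n"
  let ?\<delta> = "csqrt (of_int D)"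
  have "even (D - t)" "even (D + t)" by (auto simp: D_def)
  then obtain k l where k: "D - t = 2 * k" and l: "D + t = 2 * l"
    unfolding dvd_def by blast
  have k': "(of_int D :: complex) = of_int t + 2 * of_int k" using arg_cong[OF k, of "of_int :: int \<Rightarrow> complex"] by (simp add: algebra_simps)
  have l': "(of_int D :: complex) = 2 * of_int l - of_int t" using arg_cong[OF l, of "of_int :: int \<Rightarrow> complex"] by (simp add: algebra_simps)
  from sqrt_disc_cases consider "2 * \<tau> - of_int t = ?\<delta>" | "2 * \<tau> - of_int t = - ?\<delta>"
    unfolding D_def by blast
  then show ?thesis unfolding D_def[symmetric]
  proof cases
    case 1
    then have "(of_int D + ?\<delta>) / 2 = \<tau> + of_int k * 1" unfolding 1[symmetric] k' by (simp add: field_simps)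
    then show "lat 1 \<tau> = quad_ring D" unfolding quad_ring_def by (simp only: lat_translate)
  next
    case 2
    then have "?\<delta> = of_int t - 2 * \<tau>" by (simp add: algebra_simps)
    then have "(of_int D + ?\<delta>) / 2 = - \<tau> + of_int l * 1" unfolding l' by (simp add: field_simps)
    then show "lat 1 \<tau> = quad_ring D" unfolding quad_ring_def by (simp only: lat_translate lat_uminus)
  qed
qed

end

lemma quadratic_order_iff: "quadratic_order R \<longleftrightarrow> (\<exists>D. is_disc D \<and> R = quad_ring D)"
proof
  assume "quadratic_order R"
  then obtain \<tau> t n where "quadratic \<tau> t n" "R = lat 1 \<tau>" by (rule quadratic_order_imp_quadratic)
  then show "\<exists>D. is_disc D \<and> R = quad_ring D"
    using quadratic.is_disc quadratic.lat_eq_quad_ring by blast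
next
  assume "\<exists>D. is_disc D \<and> R = quad_ring D"
  then show "quadratic_order R"
    using quadratic.quadratic_order_lat[OF quadratic_quad_ring] unfolding quad_ring_def by blast
qed

section \<open>Isomorphic orders coincide\<close>

text \<open>The isomorphism is additive and fixes 1, so it preserves the quadratic equation of the
  generator. Both rings thus have the same discriminant, and this determines a subring of the
  complex numbers.\<close>

lemma iso_image_eq:
  assumes R: "quadratic \<tau> t n" "R = lat 1 \<tau>" and S: "quadratic_order S"
    and bij: "bij_betw f R S" and one: "f 1 = 1"
    and hom: "\<And>x y. x \<in> R \<Longrightarrow> y \<in> R \<Longrightarrow> f (x + y) = f x + f y \<and> f (x * y) = f x * f y"
  shows "S = R"
proof -
  have mem: "of_int x + of_int y * \<tau> \<in> R" for x y using latI[of x 1 y \<tau>] R(2) by simp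
  have zR: "0 \<in> R" using mem[of 0 0] by simp
  have "f 0 + f 0 = f 0" using hom[OF zR zR] by simp
  then have f0: "f 0 = 0" by simp
  have scale_nat: "f (of_nat k * z) = of_nat k * f z" if "z \<in> R" for k z
  proof (induction k)
    case (Suc k)
    have "of_nat k * z \<in> R"
      using int_mod.subspace_scale[OF subspace_lat, of z 1 \<tau> "int k"] that R(2) by simp
    then have "f (z + of_nat k * z) = f z + f (of_nat k * z)" using hom that by blast
    then show ?case using Suc by (simp add: algebra_simps)
  qed (simp add: f0)
  have neg: "f (- z) = - f z" if "z \<in> R" for z
  proof -
    have "- z \<in> R" using int_mod.subspace_neg[OF subspace_lat] that R(2) by blast
    then have "f (z + - z) = f z + f (- z)" using hom that by blast
    then show ?thesis using f0 by (simp add: eq_neg_iff_add_eq_0 add.commute)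
  qed
  have scale: "f (of_int k * z) = of_int k * f z" if z: "z \<in> R" for k z
  proof (cases k rule: int_cases2)
    case (nonneg j)
    then show ?thesis using scale_nat[OF z] by simp
  next
    case (nonpos j)
    have "of_nat j * z \<in> R"
      using int_mod.subspace_scale[OF subspace_lat, of z 1 \<tau> "int j"] that R(2) by simp
    then show ?thesis using neg[of "of_nat j * z"] scale_nat[OF z, of j] nonpos by simp
  qed
  have \<tau>R: "\<tau> \<in> R" "1 \<in> R" using R(2) by simp_all
  define \<sigma> where "\<sigma> = f \<tau>"
  have lin: "f (of_int x + of_int y * \<tau>) = of_int x + of_int y * \<sigma>" for x y
  proof -
    have "of_int x * 1 \<in> R" "of_int y * \<tau> \<in> R" using mem[of x 0] mem[of 0 y] by simp_all
    then have "f (of_int x * 1 + of_int y * \<tau>) = f (of_int x * 1) + f (of_int y * \<tau>)"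
      using hom by blast
    then show ?thesis unfolding scale[OF \<tau>R(1)] scale[OF \<tau>R(2)] one \<sigma>_def by simp
  qed
  have "S = f ` R" using bij by (simp add: bij_betw_imp_surj_on)
  also have "\<dots> = lat 1 \<sigma>"
  proof (intro equalityI subsetI)
    fix z assume "z \<in> f ` R"
    then obtain x y where "z = f (of_int x + of_int y * \<tau>)" using R(2) by (auto simp: lat_def)
    then show "z \<in> lat 1 \<sigma>" unfolding lin using latI[of x 1 y \<sigma>] by simp
  next
    fix z assume "z \<in> lat 1 \<sigma>"
    then obtain x y where "z = of_int x + of_int y * \<sigma>" by (auto simp: lat_def)
    then have "z = f (of_int x + of_int y * \<tau>)" by (simp only: lin)
    then show "z \<in> f ` R" using mem by blast
  qed
  finally have S': "S = lat 1 \<sigma>" .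
  have "\<sigma> * \<sigma> = f (\<tau> * \<tau>)" using hom \<tau>R by (simp add: \<sigma>_def)
  also have "\<tau> * \<tau> = of_int (- n) + of_int t * \<tau>" using quadratic.sq[OF R(1)] by simp
  also have "f \<dots> = of_int (- n) + of_int t * \<sigma>" by (rule lin)
  finally have sq: "\<sigma> * \<sigma> = of_int t * \<sigma> - of_int n" by simp
  \<comment> \<open>The equation of \<sigma> alone is not enough for the locale; irrationality comes
    from \<open>S\<close> being a quadratic order.\<close>
  have "\<sigma> \<notin> \<rat>"
  proof
    assume "\<sigma> \<in> \<rat>"
    then have "S \<subseteq> \<rat>" unfolding S' lat_def by auto
    moreover obtain \<rho> a b where "quadratic \<rho> a b" "S = lat 1 \<rho>" using quadratic_order_imp_quadratic[OF S] by metis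
    ultimately show False using quadratic.irr lat_gens(2) by blast
  qed
  then have "quadratic \<sigma> t n" using sq by unfold_locales
  then show ?thesis using S' R quadratic.lat_eq_quad_ring by simp
qed

lemma order_iso_eq: "order_iso = {(R, R) |R. quadratic_order R}"
proof (intro equalityI subrelI)
  fix R S assume "(R, S) \<in> order_iso"
  then obtain f where *: "quadratic_order R" "quadratic_order S" "bij_betw f R S" "f 1 = 1"
    "\<And>x y. x \<in> R \<Longrightarrow> y \<in> R \<Longrightarrow> f (x + y) = f x + f y \<and> f (x * y) = f x * f y"
    by (auto simp: order_iso_def)
  obtain \<tau> t n where "quadratic \<tau> t n" "R = lat 1 \<tau>" using quadratic_order_imp_quadratic[OF *(1)] by metis
  from iso_image_eq[OF this *(2-4)] *(5) have "S = R" by blast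
  then show "(R, S) \<in> {(R, R) |R. quadratic_order R}" using *(1) by simp
next
  fix R S assume "(R, S) \<in> {(R, R) |R. quadratic_order R}"
  then have "quadratic_order R" "S = R" by auto
  moreover have "bij_betw (\<lambda>x. x) R R" by (simp add: bij_betw_def)
  ultimately show "(R, S) \<in> order_iso" unfolding order_iso_def by (auto intro!: exI[of _ "\<lambda>x. x"])
qed

lemma order_classes_eq: "order_classes = (\<lambda>D. {quad_ring D}) ` {D. is_disc D}"
proof -
  have "order_iso `` {R} = {R}" if "quadratic_order R" for R
    using that by (auto simp: order_iso_eq)
  then have "order_classes = (\<lambda>R. {R}) ` {R. quadratic_order R}"
    unfolding order_classes_def quotient_def by auto
  also have "{R. quadratic_order R} = quad_ring ` {D. is_disc D}"
    by (auto simp: quadratic_order_iff)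
  finally show ?thesis by (simp add: image_image)
qed

lemma class_rep_singleton [simp]: "class_rep {R} = R"
  by (simp add: class_rep_def)

lemma inj_on_quad_ring: "inj_on (\<lambda>D. {quad_ring D}) {D. is_disc D}"
  by (rule inj_onI) (metis Disc_quad_ring mem_Collect_eq singleton_inject)

lemma discs_eq: "discs e X = {D. is_disc D \<and> 0 < e * D \<and> of_int (e * D) < X}"
  by (auto simp: discs_def nonsquares_def is_disc_def)

lemma imaginary_classes_eq: "imaginary_classes X = (\<lambda>D. {quad_ring D}) ` discs (- 1) X"
  unfolding imaginary_classes_def order_classes_eq discs_eq by (auto simp: Disc_quad_ring)

lemma real_classes_eq: "real_classes X = (\<lambda>D. {quad_ring D}) ` discs 1 X"
  unfolding real_classes_def order_classes_eq discs_eq by (auto simp: Disc_quad_ring)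

section \<open>Torsion ideals\<close>

lemma subspace_scaled: "int_mod.subspace S \<Longrightarrow> int_mod.subspace {z. c * z \<in> S}"
  by (auto simp: subspace_int_iff right_diff_distrib)

text \<open>With one factor fixed, the other factors whose product lies in the right-hand span form
  a submodule. So it is enough to test generators, first in one factor and then in the
  other.\<close>

lemma ideal_mult_span:
  "ideal_mult (int_mod.span A) (int_mod.span B) = int_mod.span {x * y | x y. x \<in> A \<and> y \<in> B}"
  (is "_ = int_mod.span ?P")
proof
  have sub: "int_mod.subspace {z. c * z \<in> int_mod.span ?P}" for c
    by (rule subspace_scaled) simp
  have 1: "x * y \<in> int_mod.span ?P" if "x \<in> A" "y \<in> int_mod.span B" for x y
  proof -
    have "B \<subseteq> {y. x * y \<in> int_mod.span ?P}" using that(1) by (auto intro: int_mod.span_base)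
    from int_mod.span_minimal[OF this sub] show ?thesis using that(2) by blast
  qed
  have 2: "x * y \<in> int_mod.span ?P" if "x \<in> int_mod.span A" "y \<in> int_mod.span B" for x y
  proof -
    have "A \<subseteq> {x. y * x \<in> int_mod.span ?P}" using 1 that(2) by (auto simp: mult.commute)
    from int_mod.span_minimal[OF this sub] show ?thesis using that(1) by (auto simp: mult.commute)
  qed
  show "ideal_mult (int_mod.span A) (int_mod.span B) \<subseteq> int_mod.span ?P"
    unfolding ideal_mult_def by (rule int_mod.span_minimal) (use 2 in auto)
  show "int_mod.span ?P \<subseteq> ideal_mult (int_mod.span A) (int_mod.span B)"
    unfolding ideal_mult_def by (rule int_mod.span_mono) (auto intro: int_mod.span_base)
qed

lemma ideal_multI: "x \<in> I \<Longrightarrow> y \<in> J \<Longrightarrow> x * y \<in> ideal_mult I J"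
  unfolding ideal_mult_def by (rule int_mod.span_base) blast

lemma subspace_ideal_mult: "int_mod.subspace (ideal_mult I J)"
  unfolding ideal_mult_def by simp

lemma ideal_mult_minimal:
  assumes "int_mod.subspace S" "\<And>x y. x \<in> I \<Longrightarrow> y \<in> J \<Longrightarrow> x * y \<in> S"
  shows "ideal_mult I J \<subseteq> S"
  unfolding ideal_mult_def by (rule int_mod.span_minimal) (use assms in auto)

lemma cube_lat:
  "ideal_mult (lat a b) (ideal_mult (lat a b) (lat a b)) =
     int_mod.span {a * a * a, a * a * b, a * b * b, b * b * b}"
proof -
  have "ideal_mult (lat a b) (lat a b) = int_mod.span {x * y | x y. x \<in> {a, b} \<and> y \<in> {a, b}}"
    unfolding span_pair[symmetric] by (rule ideal_mult_span)
  also have "{x * y | x y. x \<in> {a, b} \<and> y \<in> {a, b}} = {a * a, a * b, b * b}"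
    by (auto simp: mult.commute)
  finally have "ideal_mult (lat a b) (ideal_mult (lat a b) (lat a b)) =
      int_mod.span {x * y | x y. x \<in> {a, b} \<and> y \<in> {a * a, a * b, b * b}}"
    unfolding span_pair[symmetric] by (simp only: ideal_mult_span)
  also have "{x * y | x y. x \<in> {a, b} \<and> y \<in> {a * a, a * b, b * b}} = {a * a * a, a * a * b, a * b * b, b * b * b}"
    by (auto simp: mult_ac)
  finally show ?thesis .
qed

lemma span_insert_coords:
  "int_mod.span {a, b, c, d} =
    {z. \<exists>k1 k2 k3 k4::int. z = of_int k1 * a + of_int k2 * b + of_int k3 * c + of_int k4 * d}"
  (is "_ = ?S")
proof
  show "int_mod.span {a, b, c, d} \<subseteq> ?S"
  proof (rule int_mod.span_minimal)
    have "a \<in> ?S" by (rule CollectI, rule exI[of _ 1], rule exI[of _ 0], rule exI[of _ 0], rule exI[of _ 0]) simp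
    moreover have "b \<in> ?S" by (rule CollectI, rule exI[of _ 0], rule exI[of _ 1], rule exI[of _ 0], rule exI[of _ 0]) simp
    moreover have "c \<in> ?S" by (rule CollectI, rule exI[of _ 0], rule exI[of _ 0], rule exI[of _ 1], rule exI[of _ 0]) simp
    moreover have "d \<in> ?S" by (rule CollectI, rule exI[of _ 0], rule exI[of _ 0], rule exI[of _ 0], rule exI[of _ 1]) simp
    ultimately show "{a, b, c, d} \<subseteq> ?S" by blast
    show "int_mod.subspace ?S"
      unfolding subspace_int_iff
    proof (intro conjI ballI)
      show "0 \<in> ?S" by (rule CollectI, rule exI[of _ 0], rule exI[of _ 0], rule exI[of _ 0], rule exI[of _ 0]) simp
      fix z w assume "z \<in> ?S" "w \<in> ?S"
      then obtain k1 k2 k3 k4 l1 l2 l3 l4 where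
        z: "z = of_int k1 * a + of_int k2 * b + of_int k3 * c + of_int k4 * d" and
        w: "w = of_int l1 * a + of_int l2 * b + of_int l3 * c + of_int l4 * d" by blast
      have "z - w = of_int (k1 - l1) * a + of_int (k2 - l2) * b + of_int (k3 - l3) * c + of_int (k4 - l4) * d"
        unfolding z w by (simp add: algebra_simps)
      then show "z - w \<in> ?S" by blast
    qed
  qed
  show "?S \<subseteq> int_mod.span {a, b, c, d}"
  proof
    fix z assume "z \<in> ?S"
    then obtain k1 k2 k3 k4 where z: "z = of_int k1 * a + of_int k2 * b + of_int k3 * c + of_int k4 * d" by blast
    show "z \<in> int_mod.span {a, b, c, d}"
      unfolding z by (intro int_mod.span_add int_mod.span_scale) (simp_all add: int_mod.span_base)
  qed
qed

context quadratic
begin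

text \<open>Its purpose is the inverse of a torsion ideal I: it is the product of I with itself, and
  this must be a fractional ideal. The denominators multiply.\<close>

lemma fractional_ideal_mult:
  assumes I: "fractional_ideal (lat 1 \<tau>) I" and J: "fractional_ideal (lat 1 \<tau>) J"
  shows "fractional_ideal (lat 1 \<tau>) (ideal_mult I J)"
proof -
  let ?R = "lat 1 \<tau>"
  have ring: "x * y \<in> ?R" if "x \<in> ?R" "y \<in> ?R" for x y
    using that is_subring_lat by (simp add: is_subring_def)
  have Kmult: "x * y \<in> qspan \<tau>" "x - y \<in> qspan \<tau>" if "x \<in> qspan \<tau>" "y \<in> qspan \<tau>" for x y
    using that is_subfield_qspan by (simp_all add: is_subfield_def is_subring_def)
  have K0: "int_mod.subspace (qspan \<tau>)"
    unfolding subspace_int_iff using Kmult rat_vec.subspace_0[OF subspace_qspan] by simp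
  have I': "I \<subseteq> qspan \<tau>" "int_mod.subspace I" "\<And>r x. r \<in> ?R \<Longrightarrow> x \<in> I \<Longrightarrow> r * x \<in> I" "I \<noteq> {0}"
    using I by (auto simp: fractional_ideal_def fraction_field_lat)
  have J': "J \<subseteq> qspan \<tau>" "int_mod.subspace J" "J \<noteq> {0}"
    using J by (auto simp: fractional_ideal_def fraction_field_lat)
  obtain d where d: "d \<in> ?R" "d \<noteq> 0" "\<And>x. x \<in> I \<Longrightarrow> d * x \<in> ?R"
    using I unfolding fractional_ideal_def by blast
  obtain e where e: "e \<in> ?R" "e \<noteq> 0" "\<And>x. x \<in> J \<Longrightarrow> e * x \<in> ?R"
    using J unfolding fractional_ideal_def by blast
  show ?thesis
    unfolding fractional_ideal_def fraction_field_lat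
  proof (intro conjI)
    show "ideal_mult I J \<subseteq> qspan \<tau>"
      by (rule ideal_mult_minimal[OF K0]) (use I' J' Kmult in blast)
    show "int_mod.subspace (ideal_mult I J)" by (rule subspace_ideal_mult)
    show "\<forall>r\<in>?R. \<forall>z\<in>ideal_mult I J. r * z \<in> ideal_mult I J"
    proof
      fix r assume r: "r \<in> ?R"
      have "ideal_mult I J \<subseteq> {z. r * z \<in> ideal_mult I J}"
      proof (rule ideal_mult_minimal[OF subspace_scaled[OF subspace_ideal_mult]])
        fix x y assume "x \<in> I" "y \<in> J"
        then have "(r * x) * y \<in> ideal_mult I J" using I'(3)[OF r] by (intro ideal_multI)
        then show "x * y \<in> {z. r * z \<in> ideal_mult I J}" by (simp only: mem_Collect_eq mult.assoc)
      qed
      then show "\<forall>z\<in>ideal_mult I J. r * z \<in> ideal_mult I J" by blast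
    qed
    obtain x where x: "x \<in> I" "x \<noteq> 0" using I'(4) int_mod.subspace_0[OF I'(2)] by auto
    obtain y where y: "y \<in> J" "y \<noteq> 0" using J'(3) int_mod.subspace_0[OF J'(2)] by auto
    have "x * y \<in> ideal_mult I J" "x * y \<noteq> 0" using x y by (simp_all add: ideal_multI)
    then show "ideal_mult I J \<noteq> {0}" by (metis singletonD)
    show "\<exists>d\<in>?R. d \<noteq> 0 \<and> (\<forall>x\<in>ideal_mult I J. d * x \<in> ?R)"
    proof (rule bexI[of _ "d * e"], intro conjI)
      show "d * e \<noteq> 0" using d e by simp
      have "ideal_mult I J \<subseteq> {z. (d * e) * z \<in> ?R}"
      proof (rule ideal_mult_minimal[OF subspace_scaled[OF subspace_lat]])
        fix x y assume "x \<in> I" "y \<in> J"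
        then have "(d * x) * (e * y) \<in> ?R" using d(3) e(3) ring by blast
        then show "x * y \<in> {z. (d * e) * z \<in> ?R}" by (simp only: mem_Collect_eq mult_ac)
      qed
      then show "\<forall>x\<in>ideal_mult I J. d * e * x \<in> ?R" by blast
      show "d * e \<in> ?R" using ring d(1) e(1) by blast
    qed
  qed
qed

end

text \<open>The cube is generated by \<open>m\<^sup>3\<close>, \<open>m\<sigma>\<close>, \<open>s\<sigma> - mC\<close> and \<open>- k\<sigma> - sC\<close>, where \<open>\<sigma> = m\<tau>\<close>. The last
  two combine to \<open>- C\<^sup>2\<close> and to \<open>- C\<sigma>\<close>, and \<open>m\<close> is coprime to \<open>C\<close>.\<close>
lemma torsion_ideal:
  fixes m s k :: int
  assumes quad: "quadratic \<tau> s (s * s + m * k)" and m: "m > 0" and cop: "coprime s m"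
  shows "lat (of_int m) \<tau> \<in> ideal_group_3_torsion (lat 1 (of_int m * \<tau>))"
proof -
  interpret quadratic \<tau> s "s * s + m * k" by (rule quad)
  define C where "C = s * s + m * k"
  define M :: complex where "M = of_int m"
  define \<sigma> where "\<sigma> = M * \<tau>"
  have sqC: "\<tau> * \<tau> = of_int s * \<tau> - of_int C" using sq by (simp add: C_def)
  have C: "of_int C = of_int s * of_int s + M * of_int k" by (simp add: C_def M_def)
  have M0: "M \<noteq> 0" using m by (simp add: M_def)
  have \<sigma>sq: "\<sigma> * \<sigma> = of_int (m * s) * \<sigma> - of_int (m * m * C)"
  proof -
    have "\<sigma> * \<sigma> = M * M * (\<tau> * \<tau>)" by (simp add: \<sigma>_def)
    then show ?thesis unfolding sqC by (simp add: \<sigma>_def M_def algebra_simps)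
  qed
  have "\<sigma> \<notin> \<rat>"
  proof
    assume "\<sigma> \<in> \<rat>"
    then have "\<sigma> / M \<in> \<rat>" unfolding M_def by (rule Rats_divide) simp
    then show False using irr M0 by (simp add: \<sigma>_def)
  qed
  then interpret S: quadratic \<sigma> "m * s" "m * m * C" using \<sigma>sq by unfold_locales
  let ?R = "lat 1 \<sigma>" and ?I = "lat M \<tau>"
  have g2: "M * M * \<tau> = M * \<sigma>" by (simp add: \<sigma>_def)
  have g3: "M * \<tau> * \<tau> = of_int s * \<sigma> - M * of_int C"
  proof -
    have "M * \<tau> * \<tau> = M * (\<tau> * \<tau>)" by simp
    then show ?thesis unfolding sqC by (simp add: \<sigma>_def algebra_simps)
  qed
  have g4: "\<tau> * \<tau> * \<tau> = - of_int k * \<sigma> - of_int s * of_int C"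
  proof -
    have "\<tau> * \<tau> * \<tau> = (of_int s * \<tau> - of_int C) * \<tau>" by (simp only: sqC)
    also have "\<dots> = of_int s * (\<tau> * \<tau>) - of_int C * \<tau>" by (simp add: algebra_simps)
    also have "\<dots> = (of_int s * of_int s - of_int C) * \<tau> - of_int s * of_int C"
      unfolding sqC by (simp add: algebra_simps)
    also have "of_int s * of_int s - of_int C = - M * of_int k" unfolding C by simp
    finally show ?thesis by (simp add: \<sigma>_def)
  qed
  define J where "J = ideal_mult ?I (ideal_mult ?I ?I)"
  have J: "J = int_mod.span {M * M * M, M * \<sigma>, of_int s * \<sigma> - M * of_int C, - of_int k * \<sigma> - of_int s * of_int C}"
    unfolding J_def cube_lat g2 g3 g4 ..
  have subJ: "int_mod.subspace J" unfolding J by simp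
  have gens: "M * M * M \<in> J" "M * \<sigma> \<in> J" "of_int s * \<sigma> - M * of_int C \<in> J" "- of_int k * \<sigma> - of_int s * of_int C \<in> J"
    unfolding J by (simp_all add: int_mod.span_base)
  have comb: "of_int x * a + of_int y * b \<in> J" if "a \<in> J" "b \<in> J" for x y a b
    using subJ that by (intro int_mod.subspace_add int_mod.subspace_scale)
  have copC: "coprime m C"
  proof -
    have "coprime m (s * s)" using cop by (simp add: coprime_commute)
    moreover have "C = k * m + s * s" by (simp add: C_def)
    ultimately show ?thesis by (simp only: coprime_iff_gcd_eq_1 gcd_add_mult)
  qed
  have cube: "J = ?R"
  proof
    show "J \<subseteq> ?R"
      unfolding J
    proof (rule int_mod.span_minimal[OF _ subspace_lat])
      have "M * M * M \<in> ?R" using latI[of "m * m * m" 1 0 \<sigma>] by (simp add: M_def)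
      moreover have "M * \<sigma> \<in> ?R" using latI[of 0 1 m \<sigma>] by (simp add: M_def)
      moreover have "of_int s * \<sigma> - M * of_int C \<in> ?R" using latI[of "- (m * C)" 1 s \<sigma>] by (simp add: M_def)
      moreover have "- of_int k * \<sigma> - of_int s * of_int C \<in> ?R" using latI[of "- (s * C)" 1 "- k" \<sigma>] by (simp add: algebra_simps)
      ultimately show "{M * M * M, M * \<sigma>, of_int s * \<sigma> - M * of_int C, - of_int k * \<sigma> - of_int s * of_int C} \<subseteq> ?R"
        by blast
    qed
    have "of_int k * (of_int s * \<sigma> - M * of_int C) + of_int s * (- of_int k * \<sigma> - of_int s * of_int C)
        = - (of_int C * of_int C)"
      unfolding C by (simp add: algebra_simps)
    then have "- (of_int C * of_int C) \<in> J" using comb[OF gens(3,4), of k s] by simp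
    then have c1: "of_int (C * C) \<in> J" using int_mod.subspace_neg[OF subJ] by fastforce
    have "of_int (- s) * (of_int s * \<sigma> - M * of_int C) + of_int m * (- of_int k * \<sigma> - of_int s * of_int C)
        = - (of_int C * \<sigma>)"
      unfolding C M_def[symmetric] by (simp add: algebra_simps)
    then have "- (of_int C * \<sigma>) \<in> J" using comb[OF gens(3,4), of "- s" m] by simp
    then have c2: "of_int C * \<sigma> \<in> J" using int_mod.subspace_neg[OF subJ] by fastforce
    \<comment> \<open>Bezout for the cube of \<open>m\<close> and the square of \<open>C\<close>
      yields 1; below, Bezout for \<open>m\<close> and \<open>C\<close> yields \<sigma>.\<close>
    have "coprime (m * m * m) (C * C)" using copC by simp
    then obtain x y where xy: "x * (m * m * m) + y * (C * C) = 1" by (metis bezout_int coprime_imp_gcd_eq_1)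
    have "of_int x * (M * M * M) + of_int y * of_int (C * C) = of_int (x * (m * m * m) + y * (C * C))"
      by (simp add: M_def)
    then have 1: "1 \<in> J" using comb[OF gens(1) c1, of x y] unfolding xy by simp
    obtain x y where xy: "x * m + y * C = 1" using copC by (metis bezout_int coprime_imp_gcd_eq_1)
    have "of_int x * (M * \<sigma>) + of_int y * (of_int C * \<sigma>) = of_int (x * m + y * C) * \<sigma>"
      by (simp add: M_def algebra_simps)
    then have "\<sigma> \<in> J" using comb[OF gens(2) c2, of x y] unfolding xy by simp
    then show "?R \<subseteq> J" using 1 lat_subset[OF subJ] by blast
  qed
  have MI: "M \<in> ?I" "\<tau> \<in> ?I" by simp_all
  have frac: "fractional_ideal ?R ?I"
    unfolding fractional_ideal_def S.fraction_field_lat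
  proof (intro conjI)
    have MK: "M \<in> qspan \<sigma>" using qspanI[of "of_int m" 0 \<sigma>] by (simp add: M_def)
    have "of_rat (1 / of_int m) * \<sigma> = \<tau>" using M0 by (simp add: \<sigma>_def M_def of_rat_divide)
    then have "\<tau> \<in> qspan \<sigma>" using qspanI[of 0 "1 / of_int m" \<sigma>] by simp
    then have "z - w \<in> qspan \<sigma>" if "z \<in> qspan \<sigma>" "w \<in> qspan \<sigma>" for z w
      using that rat_vec.subspace_diff[OF subspace_qspan] by blast
    then have "int_mod.subspace (qspan \<sigma>)"
      unfolding subspace_int_iff using rat_vec.subspace_0[OF subspace_qspan] by blast
    then show "?I \<subseteq> qspan \<sigma>" using MK \<open>\<tau> \<in> qspan \<sigma>\<close> by (intro lat_subset)
    show "int_mod.subspace ?I" by (rule subspace_lat)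
    show "?I \<noteq> {0}" using MI(1) M0 by (metis singletonD)
    have \<sigma>I: "\<sigma> * z \<in> ?I" if "z \<in> ?I" for z
    proof -
      have "\<sigma> * M = of_int 0 * M + of_int (m * m) * \<tau>" by (simp add: \<sigma>_def M_def)
      then have "\<sigma> * M \<in> ?I" by (simp only: latI)
      moreover have "\<sigma> * \<tau> = of_int (- C) * M + of_int (m * s) * \<tau>"
        using g3 by (simp add: \<sigma>_def M_def algebra_simps)
      then have "\<sigma> * \<tau> \<in> ?I" by (simp only: latI)
      ultimately have "?I \<subseteq> {z. \<sigma> * z \<in> ?I}"
        by (intro lat_subset subspace_scaled subspace_lat) simp_all
      then show ?thesis using that by blast
    qed
    show "\<forall>r\<in>?R. \<forall>z\<in>?I. r * z \<in> ?I"
    proof (intro ballI)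
      fix r z assume r: "r \<in> ?R" and z: "z \<in> ?I"
      then obtain x y where r: "r = of_int x * 1 + of_int y * \<sigma>" by (auto simp: lat_def)
      have "r * z = of_int x * z + of_int y * (\<sigma> * z)" by (simp add: r algebra_simps)
      then show "r * z \<in> ?I" using z \<sigma>I[OF z]
        by (simp only: int_mod.subspace_add[OF subspace_lat] int_mod.subspace_scale[OF subspace_lat])
    qed
    show "\<exists>d\<in>?R. d \<noteq> 0 \<and> (\<forall>x\<in>?I. d * x \<in> ?R)"
    proof (rule bexI[of _ M], intro conjI)
      show "M \<in> ?R" using latI[of m 1 0 \<sigma>] by (simp add: M_def)
      have "M * M \<in> ?R" using latI[of "m * m" 1 0 \<sigma>] by (simp add: M_def)
      moreover have "M * \<tau> \<in> ?R" using lat_gens(2)[of \<sigma> 1] by (simp add: \<sigma>_def)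
      ultimately have "?I \<subseteq> {z. M * z \<in> ?R}"
        by (intro lat_subset subspace_scaled subspace_lat) simp_all
      then show "\<forall>x\<in>?I. M * x \<in> ?R" by blast
    qed (rule M0)
  qed
  have "?I \<in> ideal_group_3_torsion ?R"
    unfolding ideal_group_3_torsion_def ideal_group_def
    using frac S.fractional_ideal_mult[OF frac frac] cube unfolding J_def by blast
  then show ?thesis by (simp only: M_def \<sigma>_def)
qed

section \<open>From parameters to torsion ideals\<close>

definition param_ideal :: "int \<Rightarrow> nat \<times> nat \<Rightarrow> complex set" where
  "param_ideal D = (\<lambda>(m, s). lat (of_nat m) ((of_nat s + csqrt (of_int D) / of_nat m) / 2))"

text \<open>The divisibility in \<open>param_set\<close> says that D = m^2 (s^2 - 4 C) with C = s^2
  - m k. Hence \<tau> = (s + sqrt D / m) / 2 has trace s and norm C, the shape required by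
  \<open>torsion_ideal\<close> with -k for its k, and m \<tau> generates the order of discriminant
  D.\<close>

lemma param_ideal_torsion:
  assumes D: "is_disc D" and p: "(m, s) \<in> param_set D"
  shows "param_ideal D (m, s) \<in> ideal_group_3_torsion (quad_ring D)"
proof -
  have m: "m > 0" and cop: "coprime s m" and dvd: "int (4 * m ^ 3) dvd D + int (3 * m\<^sup>2 * s\<^sup>2)"
    using p by (auto simp: param_set_def)
  obtain k where k: "D + int (3 * m\<^sup>2 * s\<^sup>2) = int (4 * m ^ 3) * k" using dvd by (auto elim: dvdE)
  define C where "C = int s * int s + int m * (- k)"
  have DC: "D = int m * int m * (int s * int s - 4 * C)"
    using k by (simp add: C_def power2_eq_square power3_eq_cube algebra_simps)
  define \<delta> where "\<delta> = csqrt (of_int D)"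
  define M :: complex where "M = of_int (int m)"
  define \<tau> where "\<tau> = (of_int (int s) + \<delta> / M) / 2"
  have M0: "M \<noteq> 0" using m by (simp add: M_def)
  have \<delta>: "\<delta> = M * (2 * \<tau> - of_int (int s))" unfolding \<tau>_def using M0 by (simp add: field_simps)
  have "M * M * ((2 * \<tau> - of_int (int s)) * (2 * \<tau> - of_int (int s))) = \<delta> * \<delta>"
    unfolding \<delta> by (simp add: mult_ac)
  also have "\<dots> = M * M * of_int (int s * int s - 4 * C)"
    unfolding \<delta>_def csqrt_mult_self by (simp only: DC of_int_mult M_def)
  finally have e: "(2 * \<tau> - of_int (int s)) * (2 * \<tau> - of_int (int s)) = of_int (int s * int s - 4 * C)"
    using M0 by simp
  have "4 * (\<tau> * \<tau>) = (2 * \<tau> - of_int (int s)) * (2 * \<tau> - of_int (int s))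
      + 4 * (of_int (int s) * \<tau>) - of_int (int s) * of_int (int s)"
    by (simp add: algebra_simps)
  also have "\<dots> = 4 * (of_int (int s) * \<tau> - of_int C)"
    unfolding e by (simp add: algebra_simps)
  finally have sq: "\<tau> * \<tau> = of_int (int s) * \<tau> - of_int C" by (simp only: mult_cancel_left) simp
  have irr: "\<tau> \<notin> \<rat>"
  proof
    assume "\<tau> \<in> \<rat>"
    then have "\<delta> \<in> \<rat>" unfolding \<delta> M_def by (intro Rats_mult Rats_diff) simp_all
    then show False using csqrt_irrational[OF D] by (simp add: \<delta>_def)
  qed
  have quad: "quadratic \<tau> (int s) (int s * int s + int m * (- k))"
    using irr sq unfolding C_def by unfold_locales
  have tors: "lat M \<tau> \<in> ideal_group_3_torsion (lat 1 (M * \<tau>))"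
    unfolding M_def by (rule torsion_ideal[OF quad]) (use m cop in simp_all)
  have "quadratic (M * \<tau>) (int m * int s) (int m * int m * C)"
  proof
    show "M * \<tau> \<notin> \<rat>"
    proof
      assume "M * \<tau> \<in> \<rat>"
      then have "M * \<tau> / M \<in> \<rat>" unfolding M_def by (rule Rats_divide) simp
      then show False using irr M0 by simp
    qed
    have "M * \<tau> * (M * \<tau>) = M * M * (\<tau> * \<tau>)" by simp
    also have "\<dots> = of_int (int m * int s) * (M * \<tau>) - of_int (int m * int m * C)"
      unfolding sq M_def by (simp add: algebra_simps)
    finally show "M * \<tau> * (M * \<tau>) = of_int (int m * int s) * (M * \<tau>) - of_int (int m * int m * C)" .
  qed
  from quadratic.lat_eq_quad_ring[OF this]
  have "lat 1 (M * \<tau>) = quad_ring ((int m * int s) * (int m * int s) - 4 * (int m * int m * C))" .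
  also have "(int m * int s) * (int m * int s) - 4 * (int m * int m * C) = D"
    unfolding DC by (simp add: algebra_simps)
  finally have "lat 1 (M * \<tau>) = quad_ring D" .
  moreover have "param_ideal D (m, s) = lat M \<tau>"
    by (simp add: param_ideal_def M_def \<tau>_def \<delta>_def)
  ultimately show ?thesis using tors by simp
qed

lemma param_ideal_member:
  assumes D: "is_disc D" and m: "m > 0"
    and z: "of_rat p + of_rat q * csqrt (of_int D) \<in> param_ideal D (m, s)"
  obtains x y :: int where "p = of_int x * of_nat m + of_int y * of_nat s / 2" "q = of_int y / (2 * of_nat m)"
proof -
  let ?\<delta> = "csqrt (of_int D)"
  obtain x y :: int where "of_rat p + of_rat q * ?\<delta> = of_int x * of_nat m + of_int y * ((of_nat s + ?\<delta> / of_nat m) / 2)"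
    using z unfolding param_ideal_def lat_def by auto
  also have "\<dots> = of_rat (of_int x * of_nat m + of_int y * of_nat s / 2) + of_rat (of_int y / (2 * of_nat m)) * ?\<delta>"
    by (simp add: of_rat_add of_rat_mult of_rat_divide add_divide_distrib distrib_left)
  finally show ?thesis using that rat_coord_eq[OF csqrt_irrational[OF D]] by blast
qed

text \<open>The rational elements of the lattice are the multiples of m, which recovers m. The
  elements with coordinate 1 / (2 m) at sqrt D have rational parts s / 2 plus a multiple of m, which
  recovers s modulo 2 m.\<close>

lemma inj_on_param_ideal:
  assumes D: "is_disc D"
  shows "inj_on (param_ideal D) (param_set D)"
proof (rule inj_onI, clarify)
  let ?\<delta> = "csqrt (of_int D)"
  fix m s m' s' assume p: "(m, s) \<in> param_set D" "(m', s') \<in> param_set D"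
    and eq: "param_ideal D (m, s) = param_ideal D (m', s')"
  have pos: "m > 0" "m' > 0" and lt: "s < 2 * m" "s' < 2 * m'" using p by (auto simp: param_set_def)
  have dvd: "m' dvd m" if e: "param_ideal D (m, s) = param_ideal D (m', s')" and m': "m' > 0" for m m' s s'
  proof -
    have "of_nat m \<in> param_ideal D (m, s)" by (simp add: param_ideal_def)
    then have "of_rat (of_nat m) + of_rat 0 * ?\<delta> \<in> param_ideal D (m', s')" unfolding e by simp
    then obtain x y :: int where xy: "of_nat m = (of_int x * of_nat m' + of_int y * of_nat s' / 2 :: rat)"
      "0 = of_int y / (2 * of_nat m' :: rat)"
      by (rule param_ideal_member[OF D m'])
    then have "y = 0" using m' by simp
    then have "of_int (int m) = (of_int (x * int m') :: rat)" using xy(1) by simp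
    then have "int m = x * int m'" by (simp only: of_int_eq_iff)
    then show ?thesis by (metis dvd_triv_right int_dvd_int_iff)
  qed
  have mm: "m = m'" using dvd[OF eq pos(2)] dvd[OF eq[symmetric] pos(1)] by (rule dvd_antisym[rotated])
  have "(of_nat s + ?\<delta> / of_nat m) / 2 \<in> param_ideal D (m, s)" by (simp add: param_ideal_def)
  then have "of_rat (of_nat s / 2) + of_rat (1 / (2 * of_nat m)) * ?\<delta> \<in> param_ideal D (m', s')"
    unfolding eq by (simp add: mult.commute of_rat_mult of_rat_divide add_divide_distrib)
  then obtain x y :: int where xy: "of_nat s / 2 = (of_int x * of_nat m' + of_int y * of_nat s' / 2 :: rat)"
      "1 / (2 * of_nat m) = of_int y / (2 * of_nat m' :: rat)"
    by (rule param_ideal_member[OF D pos(2)])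
  have "y = 1" using xy(2) pos by (simp add: mm)
  then have "of_nat s = (2 * of_int x * of_nat m' + of_nat s' :: rat)" using xy(1) by (simp add: field_simps)
  then have "of_int (int s) = (of_int (2 * x * int m + int s') :: rat)" by (simp add: mm)
  then have "int s = 2 * x * int m + int s'" by (simp only: of_int_eq_iff)
  then have "int s = int s' + x * int (2 * m)" by simp
  then have "int s mod int (2 * m) = int s' mod int (2 * m)" by (simp only: mod_mult_self1)
  then have "s = s'" using lt mm by simp
  then show "m = m' \<and> s = s'" using mm by simp
qed

text \<open>Adding 2 m j to s adds the multiple j m of the first generator to the second one, and
  changes 3 m^2 s^2 by a multiple of 4 m^3. This is why s counts modulo 2 m.\<close>

lemma param_of_int:
  fixes m s D :: int
  assumes "m > 0" "coprime s m" "4 * m ^ 3 dvd D + 3 * m\<^sup>2 * s\<^sup>2"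
  obtains m' s' where "(m', s') \<in> param_set D"
    "param_ideal D (m', s') = lat (of_int m) ((of_int s + csqrt (of_int D) / of_int m) / 2)"
proof -
  define r where "r = s mod (2 * m)"
  define j where "j = s div (2 * m)"
  have s: "s = r + 2 * m * j" by (simp add: r_def j_def)
  have r: "0 \<le> r" "r < 2 * m" using assms(1) by (simp_all add: r_def)
  have "gcd m s = gcd m ((2 * j) * m + r)" unfolding s by (simp add: algebra_simps)
  also have "\<dots> = gcd m r" by (rule gcd_add_mult)
  finally have cop: "coprime r m" using assms(2) by (simp add: coprime_iff_gcd_eq_1 gcd.commute)
  have eq: "D + 3 * m\<^sup>2 * s\<^sup>2 = (D + 3 * m\<^sup>2 * r\<^sup>2) + 4 * m ^ 3 * (3 * (r * j + m * j * j))"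
    unfolding s by (simp add: power2_eq_square power3_eq_cube algebra_simps)
  have "4 * m ^ 3 dvd D + 3 * m\<^sup>2 * s\<^sup>2 - 4 * m ^ 3 * (3 * (r * j + m * j * j))"
    by (rule dvd_diff[OF assms(3) dvd_triv_left])
  then have dvd: "4 * m ^ 3 dvd D + 3 * m\<^sup>2 * r\<^sup>2" by (simp only: eq add_diff_cancel_right')
  have mr: "int (nat m) = m" "int (nat r) = r" using assms(1) r(1) by simp_all
  have "(nat m, nat r) \<in> param_set D"
    unfolding param_set_def mem_Collect_eq case_prod_conv
  proof (intro conjI)
    show "nat r < 2 * nat m" using r assms(1) by linarith
    show "coprime (nat r) (nat m)" using cop mr by (metis coprime_int_iff)
    show "int (4 * nat m ^ 3) dvd D + int (3 * (nat m)\<^sup>2 * (nat r)\<^sup>2)"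
      using dvd by (simp only: of_nat_mult of_nat_power mr of_nat_numeral)
  qed
  moreover have "param_ideal D (nat m, nat r) = lat (of_int m) ((of_int s + csqrt (of_int D) / of_int m) / 2)"
  proof -
    have m0: "of_int m \<noteq> (0::complex)" using assms(1) by simp
    have "(of_int s + csqrt (of_int D) / of_int m) / 2
      = (of_int r + csqrt (of_int D) / of_int m) / 2 + of_int j * of_int m"
      unfolding s using m0 by (simp add: add_divide_distrib)
    then have "lat (of_int m) ((of_int s + csqrt (of_int D) / of_int m) / 2)
      = lat (of_int m) ((of_int r + csqrt (of_int D) / of_int m) / 2)"
      by (simp only: lat_translate)
    moreover have "(of_nat (nat m) :: complex) = of_int m" "(of_nat (nat r) :: complex) = of_int r"
      using mr by (metis of_int_of_nat_eq)+
    ultimately show ?thesis by (simp add: param_ideal_def)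
  qed
  ultimately show ?thesis using that by blast
qed

section \<open>From torsion ideals to parameters\<close>

text \<open>Let \<alpha> and u + v \<tau> be the basis from \<open>lattice_basis\<close>. Since
  \<tau> \<alpha> lies in I, comparing coordinates gives \<alpha> = y v and u = -x v with integers
  x, y. So I is v times the lattice of y and \<rho> = \<tau> - x, and closure under \<rho> makes y
  divide the norm of \<rho>.\<close>

lemma (in quadratic) fractional_ideal_normal_form:
  assumes I: "fractional_ideal (lat 1 \<tau>) I"
  obtains v :: rat and m T c :: int and \<rho> where "v > 0" "m > 0" "quadratic \<rho> T (m * c)"
    "lat 1 \<rho> = lat 1 \<tau>" "I = lat (of_rat v * of_int m) (of_rat v * \<rho>)"
proof -
  let ?R = "lat 1 \<tau>"
  have ring: "x * y \<in> ?R" if "x \<in> ?R" "y \<in> ?R" for x y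
    using that is_subring_lat by (simp add: is_subring_def)
  have IK: "I \<subseteq> qspan \<tau>" and sub: "int_mod.subspace I" and RI: "\<And>r x. r \<in> ?R \<Longrightarrow> x \<in> I \<Longrightarrow> r * x \<in> I"
    and ne: "I \<noteq> {0}"
    using I unfolding fractional_ideal_def fraction_field_lat by blast+
  obtain d where d: "d \<in> ?R" "d \<noteq> 0" "\<And>x. x \<in> I \<Longrightarrow> d * x \<in> ?R"
    using I unfolding fractional_ideal_def by blast
  \<comment> \<open>The multiplier \<open>w\<close> is an integer multiple of the conjugate of
    \<open>z\<close>, with the sign \<open>e\<close> chosen to make the product positive.\<close>
  have conj: "\<exists>w N. w \<in> ?R \<and> N > 0 \<and> w * z = of_rat N" if zK: "z \<in> qspan \<tau>" and z0: "z \<noteq> 0" for z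
  proof -
    obtain p q where z: "z = of_rat p + of_rat q * \<tau>" using zK unfolding qspan_def by blast
    then have "p \<noteq> 0 \<or> q \<noteq> 0" using z0 by auto
    then have N: "norm_form p q \<noteq> 0" by (rule norm_form_nonzero)
    define e :: int where "e = (if norm_form p q > 0 then 1 else - 1)"
    let ?w = "of_rat (p + of_int t * q) + of_rat (- q) * \<tau>"
    have "?w \<in> qspan \<tau>" by (rule qspanI)
    then obtain M :: int where M: "M > 0" "of_int M * ?w \<in> ?R" using qspan_denominator by blast
    have "of_int e * (of_int M * ?w) \<in> ?R" by (rule int_mod.subspace_scale[OF subspace_lat M(2)])
    moreover have "of_int e * (of_int M * ?w) * z = of_int (e * M) * (z * ?w)" by (simp add: mult_ac)
    then have "of_int e * (of_int M * ?w) * z = of_rat (of_int (e * M) * norm_form p q)"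
      unfolding z norm_coords by (simp add: of_rat_mult)
    moreover have "of_int (e * M) * norm_form p q > 0"
      using N M(1) by (auto simp: e_def mult_less_0_iff not_less)
    ultimately show ?thesis by blast
  qed
  obtain x where x: "x \<in> I" "x \<noteq> 0" using ne int_mod.subspace_0[OF sub] by blast
  obtain w N where wN: "w \<in> ?R" "N > 0" "w * x = of_rat N" using conj[of x] x IK by blast
  have rat: "of_rat N \<in> I" using RI[OF wN(1) x(1)] wN(3) by simp
  have irrat: "\<tau> * of_rat N \<in> I" using RI[OF _ rat] by simp
  have irrat': "\<tau> * of_rat N \<notin> \<rat>"
  proof
    assume "\<tau> * of_rat N \<in> \<rat>"
    then have "\<tau> * of_rat N / of_rat N \<in> \<rat>" by (rule Rats_divide) simp
    then show False using irr wN(2) by simp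
  qed
  \<comment> \<open>Multiplied by \<open>b * w'\<close>, the denominator \<open>d\<close> of the
    ideal becomes the positive integer \<open>a\<close>, as \<open>lattice_basis\<close>
    expects.\<close>
  obtain w' N' where wN': "w' \<in> ?R" "N' > 0" "w' * d = of_rat N'" using conj[of d] d lat_subset_qspan by blast
  obtain a b where N': "N' = of_int a / of_int b" "b > 0" by (cases N') (auto simp: Fract_of_int_quotient)
  have apos: "a > 0" using wN'(2) N' by (simp add: zero_less_divide_iff)
  have bd: "of_int a * z \<in> lat 1 \<tau>" if "z \<in> I" for z
  proof -
    have "w' * (d * z) \<in> ?R" using ring[OF wN'(1) d(3)[OF that]] .
    then have "of_int b * (w' * (d * z)) \<in> ?R" by (rule int_mod.subspace_scale[OF subspace_lat])
    also have "of_int b * (w' * (d * z)) = of_int b * (w' * d) * z" by (simp only: mult.assoc)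
    also have "\<dots> = of_int a * z" unfolding wN'(3) N'(1) using N'(2) by (simp add: of_rat_divide)
    finally show ?thesis .
  qed
  have N0: "of_rat N \<noteq> (0::complex)" using wN(2) by simp
  obtain \<alpha> u v where auv: "(\<alpha>::rat) > 0" "v > (0::rat)" "I = lat (of_rat \<alpha>) (of_rat u + of_rat v * \<tau>)"
    by (rule lattice_basis[OF sub apos irr bd rat Rats_of_rat N0 irrat irrat'])
  have "\<tau> * of_rat \<alpha> \<in> I" using RI[of \<tau> "of_rat \<alpha>"] auv(3) by simp
  then obtain x y :: int where "\<tau> * of_rat \<alpha> = of_int x * of_rat \<alpha> + of_int y * (of_rat u + of_rat v * \<tau>)"
    unfolding auv(3) lat_def by blast
  then have "of_rat 0 + of_rat \<alpha> * \<tau> = of_rat (of_int x * \<alpha> + of_int y * u) + of_rat (of_int y * v) * \<tau>"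
    by (simp add: of_rat_mult of_rat_add algebra_simps)
  note xy = rat_coord_eq[OF irr this]
  have ypos: "y > 0" using xy(2) auv(1,2) by (simp add: zero_less_mult_iff)
  have "of_int y * (of_int x * v + u) = 0" using xy by (simp add: algebra_simps)
  then have u: "u = of_int (- x) * v" using ypos by (simp add: add_eq_0_iff)
  define \<rho> where "\<rho> = \<tau> + of_int (- x) * 1"
  define T where "T = t + 2 * (- x)"
  define n' where "n' = n + (- x) * t + x * x"
  have "\<rho> \<notin> \<rat>"
  proof
    assume "\<rho> \<in> \<rat>"
    then have "\<rho> - of_int (- x) * 1 \<in> \<rat>" by (intro Rats_diff Rats_mult) simp_all
    then show False using irr by (simp add: \<rho>_def)
  qed
  have sq\<rho>: "\<rho> * \<rho> = of_int T * \<rho> - of_int n'"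
  proof -
    have "\<rho> * \<rho> = \<tau> * \<tau> + 2 * of_int (- x) * \<tau> + of_int x * of_int x" by (simp add: \<rho>_def algebra_simps)
    then show ?thesis unfolding sq by (simp add: \<rho>_def T_def n'_def algebra_simps)
  qed
  have R\<rho>: "lat 1 \<rho> = ?R" unfolding \<rho>_def by (rule lat_translate)
  have gens: "of_rat \<alpha> = of_rat v * of_int y" "of_rat u + of_rat v * \<tau> = of_rat v * \<rho>"
    unfolding u using xy(2) by (simp_all add: \<rho>_def of_rat_mult of_rat_minus algebra_simps)
  have I': "I = lat (of_rat v * of_int y) (of_rat v * \<rho>)" unfolding auv(3) gens ..
  have "\<rho> \<in> ?R" unfolding R\<rho>[symmetric] by simp
  then have "\<rho> * (of_rat v * \<rho>) \<in> I" by (rule RI) (simp add: I')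
  then obtain i j :: int where "\<rho> * (of_rat v * \<rho>) = of_int i * (of_rat v * of_int y) + of_int j * (of_rat v * \<rho>)"
    unfolding I' lat_def by blast
  then have "of_rat v * (\<rho> * \<rho>) = of_rat v * (of_int (i * y) + of_int j * \<rho>)" by (simp add: algebra_simps)
  then have "of_int (- n') + of_int T * \<rho> = of_int (i * y) + of_int j * \<rho>" using auv(2) sq\<rho> by simp
  from int_coord_eq(1)[OF \<open>\<rho> \<notin> \<rat>\<close> this] have "n' = - (i * y)" by linarith
  then have n': "n' = y * (- i)" by (simp add: mult.commute)
  have "quadratic \<rho> T (y * (- i))" using \<open>\<rho> \<notin> \<rat>\<close> sq\<rho> unfolding n' by unfold_locales
  then show ?thesis using that[OF auv(2) ypos _ R\<rho> I'] by blast
qed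

text \<open>The numbers in the hypotheses are, up to sign, coordinates of the generators of the
  cube. Products of two of them show that q^2 divides three 2 by 2 minors, m^3 times m^2, c^2 and
  T^2 - m c. A prime dividing these last three numbers divides m and c, hence T, against
  primitivity.\<close>

lemma cube_square_dvd:
  fixes m c T q :: int
  assumes m: "m > 0" and prim: "gcd m (gcd T c) = 1" and d: "q dvd m ^ 3" "q dvd m ^ 2" "q dvd m ^ 2 * c" "q dvd m * T"
    "q dvd T * m * c" "q dvd T * T - m * c"
  shows "q ^ 2 dvd m ^ 3"
proof -
  have q2: "q ^ 2 dvd a * b" if "q dvd a" "q dvd b" for a b
    using that by (simp add: power2_eq_square mult_dvd_mono)
  define g where "g = gcd (m ^ 2) (gcd (c ^ 2) (T * T - m * c))"
  have 1: "q ^ 2 dvd m ^ 3 * m ^ 2" using q2[OF d(1,2)] .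
  have 2: "q ^ 2 dvd m ^ 3 * (T * T - m * c)" using q2[OF d(1,6)] .
  have "q ^ 2 dvd (T * m * c) * (m * T) - (m ^ 2 * c) * (T * T - m * c)"
    using q2[OF d(5,4)] q2[OF d(3,6)] by (rule dvd_diff)
  also have "(T * m * c) * (m * T) - (m ^ 2 * c) * (T * T - m * c) = m ^ 3 * c ^ 2"
    by (simp add: power2_eq_square power3_eq_cube algebra_simps)
  finally have 3: "q ^ 2 dvd m ^ 3 * c ^ 2" .
  have "q ^ 2 dvd gcd (m ^ 3 * m ^ 2) (gcd (m ^ 3 * c ^ 2) (m ^ 3 * (T * T - m * c)))"
    using 1 2 3 by simp
  also have "\<dots> = m ^ 3 * g"
  proof -
    have "gcd (m ^ 3 * a) (m ^ 3 * b) = m ^ 3 * gcd a b" for a b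
      using gcd_mult_distrib_int[of "m ^ 3" a b] m by simp
    then show ?thesis by (simp only: g_def)
  qed
  also have "g = 1"
  proof (rule ccontr)
    assume "g \<noteq> 1"
    then have "\<bar>g\<bar> \<noteq> 1" by (simp add: g_def)
    then obtain p where p: "prime p" "p dvd g" by (metis prime_factor_int)
    then have pd: "p dvd m ^ 2" "p dvd c ^ 2" "p dvd T * T - m * c" by (simp_all add: g_def)
    have "p dvd m" "p dvd c" using pd(1,2) p(1) prime_dvd_power by blast+
    then have "p dvd (T * T - m * c) + m * c" using pd(3) by (intro dvd_add) simp_all
    then have "p dvd T" using p(1) by (simp add: prime_dvd_mult_iff)
    then have "p dvd gcd m (gcd T c)" using \<open>p dvd m\<close> \<open>p dvd c\<close> by simp
    then show False using prim p(1) by (simp add: prime_int_iff)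
  qed
  finally show ?thesis by simp
qed

text \<open>The witness is \<mu> = q / m, an integer because m^2 divides q^2.\<close>

lemma square_eq_cube:
  fixes m q :: int
  assumes "q ^ 2 = m ^ 3" "q > 0" "m > 0"
  obtains \<mu> where "\<mu> > 0" "m = \<mu> ^ 2" "q = \<mu> ^ 3"
proof -
  have "m ^ 2 dvd q ^ 2" unfolding assms(1) by (simp add: power3_eq_cube power2_eq_square)
  then have "m dvd q" by simp
  then obtain \<mu> where \<mu>: "q = m * \<mu>" by auto
  have "m ^ 2 * \<mu> ^ 2 = m ^ 2 * m" using assms(1) unfolding \<mu> by (simp add: power_mult_distrib power3_eq_cube power2_eq_square)
  then have "m = \<mu> ^ 2" using assms(3) by simp
  moreover have "\<mu> > 0" using \<mu> assms(2,3) by (simp add: zero_less_mult_iff)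
  ultimately show ?thesis using that \<mu> by (simp add: power3_eq_cube power2_eq_square)
qed

text \<open>The index of the cube of I in the order is (v^2 m)^3 when I is primitive, and equality
  with the order makes it 1. In integers this is q^2 = m^3 with q = 1 / v^3, so q and m are the cube
  and the square of one \<mu>. The conditions on s are then read off from the coordinates that q
  must divide.\<close>

lemma torsion_params:
  fixes v :: rat and m T c :: int
  assumes quad: "quadratic \<rho> T (m * c)" and v: "v > 0" and m: "m > 0"
    and I: "I = lat (of_rat v * of_int m) (of_rat v * \<rho>)"
    and cube: "ideal_mult I (ideal_mult I I) = lat 1 \<rho>"
  obtains \<mu> s where "\<mu> > 0" "m = \<mu> ^ 2" "v = 1 / of_int \<mu>" "T = \<mu> * s" "coprime s \<mu>" "\<mu> dvd s * s - c"
proof -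
  interpret quadratic \<rho> T "m * c" by (rule quad)
  let ?R = "lat 1 \<rho>"
  define g where "g = gcd m (gcd T c)"
  have gpos: "g > 0" using m by (simp add: g_def)
  have "g = 1"
  proof -
    have "g dvd m" "g dvd T" "g dvd c" unfolding g_def by (meson gcd_dvd1 gcd_dvd2 dvd_trans)+
    then obtain m1 T1 c1 where g: "m = g * m1" "T = g * T1" "c = g * c1" by (auto elim!: dvdE)
    \<comment> \<open>Division by a common factor \<open>g\<close> gives a multiplier of I, hence of
      its cube, which is the order. So \<open>x\<close> would lie in the order, which forces g =
      1.\<close>
    define x where "x = \<rho> / of_int g"
    have g0: "of_int g \<noteq> (0::complex)" using gpos by simp
    have x\<rho>: "x * of_int g = \<rho>" using g0 by (simp add: x_def)
    have "x * (of_rat v * of_int m) = of_int 0 * (of_rat v * of_int m) + of_int m1 * (of_rat v * \<rho>)"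
      using x\<rho> unfolding g(1) by (simp add: mult_ac)
    then have 1: "x * (of_rat v * of_int m) \<in> I" unfolding I by (simp only: latI)
    have "x * \<rho> * of_int g = \<rho> * \<rho>" using x\<rho> by (simp add: mult_ac)
    also have "\<dots> = (of_int T1 * \<rho> - of_int c1 * of_int m) * of_int g"
      unfolding sq by (simp add: g(2,3) algebra_simps)
    finally have x2: "x * \<rho> = of_int T1 * \<rho> - of_int c1 * of_int m" using g0 by (simp only: mult_cancel_right) simp
    have "x * (of_rat v * \<rho>) = of_rat v * (x * \<rho>)" by (simp only: mult_ac)
    also have "\<dots> = of_int (- c1) * (of_rat v * of_int m) + of_int T1 * (of_rat v * \<rho>)"
      unfolding x2 by (simp add: algebra_simps)
    finally have "x * (of_rat v * \<rho>) = of_int (- c1) * (of_rat v * of_int m) + of_int T1 * (of_rat v * \<rho>)" .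
    then have 2: "x * (of_rat v * \<rho>) \<in> I" unfolding I by (simp only: latI)
    have xI: "I \<subseteq> {z. x * z \<in> I}"
      using 1 2 unfolding I by (intro lat_subset subspace_scaled subspace_lat) simp_all
    have "ideal_mult I (ideal_mult I I) \<subseteq> {z. x * z \<in> ideal_mult I (ideal_mult I I)}"
    proof (rule ideal_mult_minimal[OF subspace_scaled[OF subspace_ideal_mult]])
      fix a b assume a: "a \<in> I" and b: "b \<in> ideal_mult I I"
      then have "(x * a) * b \<in> ideal_mult I (ideal_mult I I)" using xI by (intro ideal_multI) auto
      then show "a * b \<in> {z. x * z \<in> ideal_mult I (ideal_mult I I)}" by (simp only: mem_Collect_eq mult.assoc)
    qed
    then have "x * 1 \<in> ?R" unfolding cube using lat_gens(1)[of 1 \<rho>] by blast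
    then obtain a b :: int where "x = of_int a + of_int b * \<rho>" by (auto simp: lat_def)
    then have "\<rho> = (of_int a + of_int b * \<rho>) * of_int g" using x\<rho> by simp
    then have "of_int 0 + of_int 1 * \<rho> = of_int (a * g) + of_int (b * g) * \<rho>" by (simp add: algebra_simps)
    from int_coord_eq(2)[OF irr this] have "g dvd 1" by (metis dvd_triv_right)
    then show ?thesis using gpos by simp
  qed
  then have prim: "gcd m (gcd T c) = 1" by (simp add: g_def)
  define V :: rat where "V = v * v * v"
  have V: "V > 0" using v by (simp add: V_def)
  have g1: "(of_rat v * of_int m) * (of_rat v * of_int m) * (of_rat v * of_int m)
      = of_rat V * (of_int (m ^ 3) + of_int 0 * \<rho>)"
    by (simp add: V_def of_rat_mult power3_eq_cube mult_ac)
  have g2: "(of_rat v * of_int m) * (of_rat v * of_int m) * (of_rat v * \<rho>)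
      = of_rat V * (of_int 0 + of_int (m ^ 2) * \<rho>)"
    by (simp add: V_def of_rat_mult power2_eq_square mult_ac)
  have g3: "(of_rat v * of_int m) * (of_rat v * \<rho>) * (of_rat v * \<rho>)
      = of_rat V * (of_int (- (m ^ 2 * c)) + of_int (m * T) * \<rho>)"
  proof -
    have "(of_rat v * of_int m) * (of_rat v * \<rho>) * (of_rat v * \<rho>) = of_rat V * (of_int m * (\<rho> * \<rho>))"
      by (simp add: V_def of_rat_mult mult_ac)
    then show ?thesis unfolding sq by (simp add: power2_eq_square algebra_simps)
  qed
  have g4: "(of_rat v * \<rho>) * (of_rat v * \<rho>) * (of_rat v * \<rho>)
      = of_rat V * (of_int (- (T * m * c)) + of_int (T * T - m * c) * \<rho>)"
  proof -
    have "(of_rat v * \<rho>) * (of_rat v * \<rho>) * (of_rat v * \<rho>) = of_rat V * (\<rho> * \<rho> * \<rho>)"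
      by (simp add: V_def of_rat_mult mult_ac)
    also have "\<rho> * \<rho> * \<rho> = (of_int T * \<rho> - of_int (m * c)) * \<rho>" by (simp only: sq)
    also have "\<dots> = of_int T * (\<rho> * \<rho>) - of_int (m * c) * \<rho>" by (simp add: algebra_simps)
    also have "\<dots> = of_int (- (T * m * c)) + of_int (T * T - m * c) * \<rho>"
      unfolding sq by (simp add: algebra_simps)
    finally show ?thesis .
  qed
  let ?G = "{of_rat V * (of_int (m ^ 3) + of_int 0 * \<rho>), of_rat V * (of_int 0 + of_int (m ^ 2) * \<rho>),
    of_rat V * (of_int (- (m ^ 2 * c)) + of_int (m * T) * \<rho>),
    of_rat V * (of_int (- (T * m * c)) + of_int (T * T - m * c) * \<rho>)}"
  have R: "?R = int_mod.span ?G" using cube unfolding I cube_lat g1 g2 g3 g4 by simp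
  have comb: "\<exists>k1 k2 k3 k4. a = V * of_int (k1 * m ^ 3 - k3 * (m ^ 2 * c) - k4 * (T * m * c)) \<and>
      b = V * of_int (k2 * m ^ 2 + k3 * (m * T) + k4 * (T * T - m * c))"
    if mem: "of_rat a + of_rat b * \<rho> \<in> ?R" for a b
  proof -
    obtain k1 k2 k3 k4 :: int where "of_rat a + of_rat b * \<rho> =
       of_int k1 * (of_rat V * (of_int (m ^ 3) + of_int 0 * \<rho>)) + of_int k2 * (of_rat V * (of_int 0 + of_int (m ^ 2) * \<rho>))
     + of_int k3 * (of_rat V * (of_int (- (m ^ 2 * c)) + of_int (m * T) * \<rho>))
     + of_int k4 * (of_rat V * (of_int (- (T * m * c)) + of_int (T * T - m * c) * \<rho>))"
      using mem unfolding R span_insert_coords by blast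
    also have "\<dots> = of_rat V * of_int (k1 * m ^ 3 - k3 * (m ^ 2 * c) - k4 * (T * m * c))
      + of_rat V * of_int (k2 * m ^ 2 + k3 * (m * T) + k4 * (T * T - m * c)) * \<rho>"
      by (simp add: algebra_simps)
    also have "\<dots> = of_rat (V * of_int (k1 * m ^ 3 - k3 * (m ^ 2 * c) - k4 * (T * m * c)))
      + of_rat (V * of_int (k2 * m ^ 2 + k3 * (m * T) + k4 * (T * T - m * c))) * \<rho>"
      by (simp only: of_rat_mult of_rat_of_int_eq)
    finally show ?thesis using rat_coord_eq[OF irr] by blast
  qed
  have "of_rat 1 + of_rat 0 * \<rho> \<in> ?R" by simp
  from comb[OF this] obtain k1 k2 k3 k4 where
    k: "1 = V * of_int (k1 * m ^ 3 - k3 * (m ^ 2 * c) - k4 * (T * m * c))"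
      "0 = V * of_int (k2 * m ^ 2 + k3 * (m * T) + k4 * (T * T - m * c))" by blast
  have "of_rat 0 + of_rat 1 * \<rho> \<in> ?R" by simp
  from comb[OF this] obtain l1 l2 l3 l4 where
    l: "0 = V * of_int (l1 * m ^ 3 - l3 * (m ^ 2 * c) - l4 * (T * m * c))"
      "1 = V * of_int (l2 * m ^ 2 + l3 * (m * T) + l4 * (T * T - m * c))" by blast
  \<comment> \<open>Since 1 is in the span of the generators, 1 / V is an integer.\<close>
  define q where "q = k1 * m ^ 3 - k3 * (m ^ 2 * c) - k4 * (T * m * c)"
  have Vq: "V * of_int q = 1" using k(1) by (simp add: q_def)
  then have qpos: "q > 0" using V by (metis of_int_0_less_iff zero_less_mult_pos zero_less_one)
  have q2: "l2 * m ^ 2 + l3 * (m * T) + l4 * (T * T - m * c) = q"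
  proof -
    have "V * of_int (l2 * m ^ 2 + l3 * (m * T) + l4 * (T * T - m * c)) = V * of_int q" by (simp only: l(2)[symmetric] Vq)
    then have "of_int (l2 * m ^ 2 + l3 * (m * T) + l4 * (T * T - m * c)) = (of_int q :: rat)"
      using V by (simp only: mult_cancel_left) simp
    then show ?thesis by (simp only: of_int_eq_iff)
  qed
  have zero: "x = 0" if "0 = V * of_int x" for x :: int using that V by simp
  have k0: "k2 * m ^ 2 + k3 * (m * T) + k4 * (T * T - m * c) = 0"
    by (rule zero[OF k(2)])
  have l0: "l1 * m ^ 3 - l3 * (m ^ 2 * c) - l4 * (T * m * c) = 0"
    by (rule zero[OF l(1)])
  \<comment> \<open>An element of the order has integral coordinates, here
    \<open>V * a = a / q\<close> and \<open>V * b = b / q\<close>.\<close>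
  have dvd: "q dvd a" "q dvd b" if mem: "of_rat V * (of_int a + of_int b * \<rho>) \<in> ?R" for a b
  proof -
    obtain x y :: int where "of_rat V * (of_int a + of_int b * \<rho>) = of_int x + of_int y * \<rho>"
      using mem by (auto simp: lat_def)
    then have "of_rat (V * of_int a) + of_rat (V * of_int b) * \<rho> = of_rat (of_int x) + of_rat (of_int y) * \<rho>"
      by (simp add: of_rat_mult algebra_simps)
    note xy = rat_coord_eq[OF irr this]
    have "of_int (q * x) = (V * of_int q) * of_int a" using xy(1) by (simp add: mult_ac)
    then have "q * x = a" unfolding Vq mult_1_left by (simp only: of_int_eq_iff)
    then show "q dvd a" by (metis dvd_triv_left)
    have "of_int (q * y) = (V * of_int q) * of_int b" using xy(2) by (simp add: mult_ac)
    then have "q * y = b" unfolding Vq mult_1_left by (simp only: of_int_eq_iff)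
    then show "q dvd b" by (metis dvd_triv_left)
  qed
  have gen: "z \<in> ?R" if "z \<in> ?G" for z unfolding R using that by (rule int_mod.span_base)
  have d1: "q dvd m ^ 3" by (rule dvd(1)[of _ 0]) (rule gen, simp only: insert_iff simp_thms)
  have d2: "q dvd m ^ 2" by (rule dvd(2)[of 0]) (rule gen, simp only: insert_iff simp_thms)
  have d3: "q dvd - (m ^ 2 * c)" by (rule dvd(1)[of _ "m * T"]) (rule gen, simp only: insert_iff simp_thms)
  have d4: "q dvd m * T" by (rule dvd(2)[of "- (m ^ 2 * c)"]) (rule gen, simp only: insert_iff simp_thms)
  have d5: "q dvd - (T * m * c)" by (rule dvd(1)[of _ "T * T - m * c"]) (rule gen, simp only: insert_iff simp_thms)
  have d6: "q dvd T * T - m * c" by (rule dvd(2)[of "- (T * m * c)"]) (rule gen, simp only: insert_iff simp_thms)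
  have "q ^ 2 dvd m ^ 3"
    by (rule cube_square_dvd[OF m prim d1 d2 _ d4 _ d6]) (use d3 d5 in simp_all)
  moreover have "m ^ 3 dvd q ^ 2"
  proof -
    \<comment> \<open>Cauchy-Binet: the coefficients \<open>k\<close> and \<open>l\<close> send the
      four generators, divided by V, to q and q \<rho>. The determinant q^2 is therefore a
      combination of their 2 by 2 minors, all multiples of m^3.\<close>
    have "q ^ 2 = q * (l2 * m ^ 2 + l3 * (m * T) + l4 * (T * T - m * c))
       - (l1 * m ^ 3 - l3 * (m ^ 2 * c) - l4 * (T * m * c)) * (k2 * m ^ 2 + k3 * (m * T) + k4 * (T * T - m * c))"
      unfolding q2 l0 by (simp add: power2_eq_square)
    also have "\<dots> = m ^ 3 * ((k1 * l2 - l1 * k2) * m ^ 2 + (k1 * l3 - l1 * k3) * (m * T)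
        + (k1 * l4 - l1 * k4) * (T * T - m * c) + (k2 * l3 - l2 * k3) * (m * c)
        + (k2 * l4 - l2 * k4) * (T * c) + (k3 * l4 - l3 * k4) * (c * c))"
      unfolding q_def by (simp add: power2_eq_square power3_eq_cube algebra_simps)
    finally show ?thesis by simp
  qed
  ultimately have "q ^ 2 = m ^ 3" using qpos m by (simp add: zdvd_antisym_nonneg)
  then obtain \<mu> where \<mu>: "\<mu> > 0" "m = \<mu> ^ 2" "q = \<mu> ^ 3" by (rule square_eq_cube[OF _ qpos m])
  have \<mu>0: "(of_int \<mu> :: rat) > 0" using \<mu>(1) by simp
  \<comment> \<open>A nonnegative rational number with cube 1 is 1.\<close>
  have cube1: "(v * of_int \<mu>) ^ 3 = 1 ^ 3" using Vq unfolding V_def \<mu>(3) by (simp add: power3_eq_cube mult_ac)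
  have "0 \<le> v * of_int \<mu>" using v \<mu>0 by (intro mult_nonneg_nonneg less_imp_le)
  from power_eq_imp_eq_base[OF cube1 this zero_le_one] have "v * of_int \<mu> = 1" by simp
  then have v': "v = 1 / of_int \<mu>" using \<mu>0 by (metis less_irrefl nonzero_eq_divide_eq)
  have "\<mu> ^ 2 * \<mu> dvd \<mu> ^ 2 * T" using d4 unfolding \<mu>(2,3) by (simp add: power3_eq_cube power2_eq_square)
  then have "\<mu> dvd T" using \<mu>(1) by simp
  then obtain s where s: "T = \<mu> * s" by auto
  have "\<mu> ^ 2 * \<mu> dvd \<mu> ^ 2 * (s * s - c)"
    using d6 unfolding \<mu>(2,3) s by (simp add: power3_eq_cube power2_eq_square algebra_simps)
  then have sc: "\<mu> dvd s * s - c" using \<mu>(1) by simp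
  \<comment> \<open>A common divisor divides m and T and, through s^2 - c, also c; primitivity makes
    it a unit.\<close>
  have "coprime s \<mu>"
  proof (rule coprimeI)
    fix h assume h: "h dvd s" "h dvd \<mu>"
    have "h dvd s * s - (s * s - c)" using h sc by (meson dvd_diff dvd_mult dvd_trans)
    then have "h dvd c" by simp
    moreover have "h dvd m" "h dvd T" using h by (simp_all add: \<mu>(2) s power2_eq_square)
    ultimately have "h dvd gcd m (gcd T c)" by simp
    then show "is_unit h" using prim by simp
  qed
  then show ?thesis using that \<mu>(1,2) v' s sc by blast
qed

text \<open>With m = \<mu>^2 and T = \<mu> s the discriminant is D = \<mu>^2 (s^2 - 4 c). So D + 3
  \<mu>^2 s^2 = 4 \<mu>^2 (s^2 - c), and \<mu> | s^2 - c turns this into the divisibility by 4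
  \<mu>^3.\<close>

lemma torsion_ideal_param:
  assumes D: "is_disc D" and I: "I \<in> ideal_group_3_torsion (quad_ring D)"
  shows "I \<in> param_ideal D ` param_set D"
proof -
  interpret R: quadratic "(of_int D + csqrt (of_int D)) / 2" D "(D * D - D) div 4"
    by (rule quadratic_quad_ring[OF D])
  have "fractional_ideal (quad_ring D) I" and cube: "ideal_mult I (ideal_mult I I) = quad_ring D"
    using I by (simp_all add: ideal_group_3_torsion_def ideal_group_def)
  then obtain v :: rat and m T c :: int and \<rho> where v: "v > 0" and m: "m > 0" and quad: "quadratic \<rho> T (m * c)"
    and R: "lat 1 \<rho> = quad_ring D" and I': "I = lat (of_rat v * of_int m) (of_rat v * \<rho>)"
    unfolding quad_ring_def using R.fractional_ideal_normal_form by metis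
  obtain \<mu> s where \<mu>: "\<mu> > 0" "m = \<mu> ^ 2" "v = 1 / of_int \<mu>" "T = \<mu> * s" and cop: "coprime s \<mu>"
    and dvd: "\<mu> dvd s * s - c"
    using torsion_params[OF quad v m I'] cube R by metis
  have "Disc (lat 1 \<rho>) = T * T - 4 * (m * c)" by (rule quadratic.Disc_lat[OF quad])
  then have DT: "D = T * T - 4 * (m * c)" unfolding R Disc_quad_ring[OF D] .
  then have Ds: "D = \<mu> ^ 2 * (s * s - 4 * c)" by (simp add: \<mu> power2_eq_square algebra_simps)
  obtain j where j: "s * s - c = \<mu> * j" using dvd by auto
  have "D + 3 * \<mu>\<^sup>2 * s\<^sup>2 = 4 * \<mu> ^ 2 * (s * s - c)" by (simp add: Ds power2_eq_square algebra_simps)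
  also have "\<dots> = 4 * \<mu> ^ 3 * j" unfolding j by (simp add: power2_eq_square power3_eq_cube)
  finally have dvd1: "4 * \<mu> ^ 3 dvd D + 3 * \<mu>\<^sup>2 * s\<^sup>2" by simp
  then have dvd2: "4 * \<mu> ^ 3 dvd D + 3 * \<mu>\<^sup>2 * (- s)\<^sup>2" by simp
  let ?\<delta> = "csqrt (of_int D)"
  let ?M = "of_int \<mu> :: complex"
  have M0: "?M \<noteq> 0" using \<mu>(1) by simp
  have v': "of_rat v = 1 / ?M" by (simp add: \<mu>(3) of_rat_divide)
  have "of_rat v * of_int m = ?M" unfolding v' \<mu>(2) using M0 by (simp add: power2_eq_square)
  then have I2: "I = lat ?M (\<rho> / ?M)" unfolding I' v' by simp
  have "2 * \<rho> - of_int T = ?\<delta> \<or> 2 * \<rho> - of_int T = - ?\<delta>"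
    using quadratic.sqrt_disc_cases[OF quad] unfolding DT .
  then consider "\<rho> = (of_int T + ?\<delta>) / 2" | "- \<rho> = (- of_int T + ?\<delta>) / 2"
    by (auto simp: field_simps)
  then show ?thesis
  proof cases
    case 1
    have e: "\<rho> / ?M = (of_int s + ?\<delta> / ?M) / 2"
      unfolding 1 \<mu>(4) using M0 by (simp add: field_simps)
    then have "I = lat ?M ((of_int s + ?\<delta> / ?M) / 2)" by (simp only: I2 e)
    then show ?thesis using param_of_int[OF \<mu>(1) cop dvd1] by (metis image_eqI)
  next
    \<comment> \<open>Here \<rho> involves the root that \<open>csqrt\<close> does not select.
      Negating the second generator keeps the lattice and replaces s by -s, which respects the
      divisibility.\<close>
    case 2
    have "- (\<rho> / ?M) = (- \<rho>) / ?M" by simp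
    also have "\<dots> = (of_int (- s) + ?\<delta> / ?M) / 2"
      unfolding 2 \<mu>(4) using M0 by (simp add: field_simps)
    finally have "I = lat ?M ((of_int (- s) + ?\<delta> / ?M) / 2)"
      unfolding I2 by (metis lat_uminus)
    moreover have "coprime (- s) \<mu>" using cop by simp
    ultimately show ?thesis using param_of_int[OF \<mu>(1) _ dvd2] by (metis image_eqI)
  qed
qed

section \<open>Passage to isomorphism classes\<close>

lemma card_ideal_group_3_torsion:
  assumes "is_disc D"
  shows "card (ideal_group_3_torsion (quad_ring D)) = card (param_set D)"
proof -
  have "ideal_group_3_torsion (quad_ring D) = param_ideal D ` param_set D"
    using torsion_ideal_param[OF assms] param_ideal_torsion[OF assms] by auto
  then show ?thesis using card_image[OF inj_on_param_ideal[OF assms]] by simp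
qed

lemma sum_over_classes:
  "(\<Sum>C\<in>(\<lambda>D. {quad_ring D}) ` discs e X. f (class_rep C)) = (\<Sum>D\<in>discs e X. f (quad_ring D))"
proof -
  have "inj_on (\<lambda>D. {quad_ring D}) (discs e X)"
    using inj_on_quad_ring by (rule inj_on_subset) (auto simp: discs_eq)
  then show ?thesis by (simp add: sum.reindex)
qed

lemma average_over_classes:
  "(\<Sum>C\<in>(\<lambda>D. {quad_ring D}) ` discs e X. real (card (ideal_group_3_torsion (class_rep C)))) /
     (\<Sum>C\<in>(\<lambda>D. {quad_ring D}) ` discs e X. 1) =
   (\<Sum>D\<in>discs e X. real (card (param_set D))) / real (card (discs e X))"
proof -
  have "(\<Sum>D\<in>discs e X. real (card (ideal_group_3_torsion (quad_ring D)))) = (\<Sum>D\<in>discs e X. real (card (param_set D)))"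
    by (rule sum.cong) (simp_all add: discs_eq card_ideal_group_3_torsion)
  moreover have "(\<Sum>C\<in>(\<lambda>D. {quad_ring D}) ` discs e X. 1) = real (card (discs e X))"
    using sum_over_classes[of "\<lambda>_. 1 :: real" e X] by simp
  ultimately show ?thesis
    using sum_over_classes[of "\<lambda>R. real (card (ideal_group_3_torsion R))" e X] by simp
qed

theorem theorem6:
  "((\<lambda>X::real. (\<Sum>C\<in>imaginary_classes X. real (card (ideal_group_3_torsion (class_rep C)))) /
        (\<Sum>C\<in>imaginary_classes X. 1)) \<longlongrightarrow> zeta 2 / zeta 3) at_top
   \<and> ((\<lambda>X::real. (\<Sum>C\<in>real_classes X. real (card (ideal_group_3_torsion (class_rep C)))) /
        (\<Sum>C\<in>real_classes X. 1)) \<longlongrightarrow> zeta 2 / zeta 3) at_top"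
  unfolding imaginary_classes_eq real_classes_eq average_over_classes
  by (intro conjI average_card_param_set) simp_all

end
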